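(* Let $\tilde M$ be a Kenmotsu manifold with structure $(\phi,\xi,\eta,g)$, and let $M=N_\perp\times_f N_\theta$ be a warped product submanifold of $\tilde M$ such that $\xi\in TN_\perp$, where $N_\perp$ is an anti-invariant submanifold and $N_\theta$ is a proper slant submanifold of $\tilde M$ (with $\phi(TN_\perp)\subseteq T^\perp M$). Then $$\eta(Z)=Z\ln f\qquad\text{for all } Z\in TN_\perp.$$
   Context: An almost contact metric structure on a $(2n+1)$-dimensional smooth manifold $\tilde M$ is $(\phi,\xi,\eta,g)$ with $\phi$ a $(1,1)$-tensor field, $\xi$ a vector field, $\eta$ a 1-form and $g$ a Riemannian metric such that $\phi^2=-I+\eta\otimes\xi$, $\eta(\xi)=1$, $\eta\circ\phi=0$, $\phi\xi=0$, $g(X,Y)=g(\phi X,\phi Y)+\eta(X)\eta(Y)$, $g(X,\phi Y)=-g(\phi X,Y)$, $g(X,\xi)=\eta(X)$. It is Kenmotsu if $(\tilde\nabla_X\phi)Y=g(\phi X,Y)\xi-\eta(Y)\phi X$ for all $X,Y\in T\tilde M$, where $\tilde\nabla$ is the Levi-Civita connection of $g$. For a submanifold $M$ of $\tilde M$, $T^\perp M$ denotes its normal bundle; throughout, $\xi$ is tangent to $M$. A submanifold $P$ of $\tilde M$ is anti-invariant if $\phi(TP)\subseteq T^\perp P$. It is slant if the angle between $\phi X$ and the tangent space of $P$ is a constant $\theta$ (the slant angle) for all nonzero tangent vectors $X$ of $P$ not proportional to $\xi$; it is proper slant if $\theta\neq0,\pi/2$. The warped product $N_1\times_f N_2$ of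 (positive-dimensional) Riemannian manifolds $(N_1,g_1)$, $(N_2,g_2)$, with $f$ a positive differentiable function on $N_1$, is $N_1\times N_2$ with metric $g_1+f^2g_2$. A warped product submanifold of $\tilde M$ is a submanifold whose induced metric is such a warped product metric; $TN_1$ and $TN_2$ are regarded as subbundles of $TM$. The submanifold $M=N_\perp\times_fN_\theta$ is of the kind the paper calls anti-slant: the distribution $TN_\perp$ satisfies $\phi(TN_\perp)\subseteq T^\perp M$ and $TN_\theta$ is slant with slant angle $\theta\ne 0$. *)

theory Defs
  imports "HOL-Analysis.Analysis" "HOL-Library.Function_Algebras"
begin

instantiation "fun" :: (type, real_vector) real_vector
begin

definition scaleR_fun :: "real \<Rightarrow> ('a \<Rightarrow> 'b) \<Rightarrow> 'a \<Rightarrow> 'b" where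
  "scaleR_fun r f = (\<lambda>x. r *\<^sub>R f x)"

instance
  by standard (auto simp: scaleR_fun_def plus_fun_def scaleR_add_left scaleR_add_right)

end

section \<open>Smooth manifolds\<close>

text \<open>
  A chart is a pair \<open>(U, x)\<close> of a domain and a coordinate map; the values of \<open>x\<close> outside \<open>U\<close> are
  irrelevant. A manifold is a type together with a smooth, not necessarily maximal, atlas covering it.
\<close>

type_synonym ('a, 'b) chart = "'a set \<times> ('a \<Rightarrow> 'b)"

primrec Ck_on :: "nat \<Rightarrow> 'a::euclidean_space set \<Rightarrow> ('a \<Rightarrow> 'b::real_normed_vector) \<Rightarrow> bool" where
  "Ck_on 0 S f \<longleftrightarrow> continuous_on S f"
| "Ck_on (Suc k) S f \<longleftrightarrow> (\<forall>x\<in>S. f differentiable (at x)) \<and>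
     (\<forall>v. Ck_on k S (\<lambda>x. frechet_derivative f (at x) v))"

text \<open>Only meaningful for open \<open>S\<close>.\<close>
definition smooth_on :: "'a::euclidean_space set \<Rightarrow> ('a \<Rightarrow> 'b::real_normed_vector) \<Rightarrow> bool" where
  "smooth_on S f \<longleftrightarrow> (\<forall>k. Ck_on k S f)"

abbreviation chart_inv :: "('a, 'b) chart \<Rightarrow> 'b \<Rightarrow> 'a" where
  "chart_inv c \<equiv> inv_into (fst c) (snd c)"

definition smooth_atlas :: "('a::topological_space, 'b::euclidean_space) chart set \<Rightarrow> bool" where
  "smooth_atlas A \<longleftrightarrow>
     (\<forall>c\<in>A. open (fst c) \<and> open (snd c ` fst c) \<and>
        homeomorphism (fst c) (snd c ` fst c) (snd c) (chart_inv c)) \<and>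
     (\<Union>c\<in>A. fst c) = UNIV \<and>
     (\<forall>c\<in>A. \<forall>d\<in>A. smooth_on (snd c ` (fst c \<inter> fst d)) (snd d \<circ> chart_inv c))"

definition product_atlas ::
  "('a, 'b) chart set \<Rightarrow> ('c, 'd) chart set \<Rightarrow> ('a \<times> 'c, 'b \<times> 'd) chart set" where
  "product_atlas A B = {(fst c \<times> fst d, map_prod (snd c) (snd d)) | c d. c \<in> A \<and> d \<in> B}"

definition smooth_fun ::
  "('a, 'b::euclidean_space) chart set \<Rightarrow> ('a \<Rightarrow> real) \<Rightarrow> bool" where
  "smooth_fun A h \<longleftrightarrow> (\<forall>c\<in>A. smooth_on (snd c ` fst c) (h \<circ> chart_inv c))"

definition smooth_map :: "('a::topological_space, 'b::euclidean_space) chart set \<Rightarrow>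
    ('c::topological_space, 'd::euclidean_space) chart set \<Rightarrow> ('a \<Rightarrow> 'c) \<Rightarrow> bool" where
  "smooth_map A B F \<longleftrightarrow> continuous_on UNIV F \<and>
     (\<forall>c\<in>A. \<forall>d\<in>B. smooth_on (snd c ` (fst c \<inter> F -` fst d)) (snd d \<circ> F \<circ> chart_inv c))"

section \<open>Tangent vectors\<close>

text \<open>
  A tangent vector at \<open>p\<close> is the family of its coordinate vectors in the charts around \<open>p\<close>,
  transforming under a change of chart by the derivative of the transition map. The family is \<open>0\<close> at
  all other indices, so that equality of tangent vectors is equality of functions.
\<close>

type_synonym ('a, 'b) tangent = "('a, 'b) chart \<Rightarrow> 'b"

definition tangent_space ::
  "('a, 'b::euclidean_space) chart set \<Rightarrow> 'a \<Rightarrow> ('a, 'b) tangent set" where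
  "tangent_space A p = {v.
     (\<forall>c. \<not> (c \<in> A \<and> p \<in> fst c) \<longrightarrow> v c = 0) \<and>
     (\<forall>c\<in>A. \<forall>d\<in>A. p \<in> fst c \<inter> fst d \<longrightarrow>
        v d = frechet_derivative (snd d \<circ> chart_inv c) (at (snd c p)) (v c))}"

definition chart_at :: "('a, 'b) chart set \<Rightarrow> 'a \<Rightarrow> ('a, 'b) chart" where
  "chart_at A p = (SOME c. c \<in> A \<and> p \<in> fst c)"

text \<open>The next two notions do not depend on the chart around \<open>p\<close> used to compute them.\<close>

definition dir_deriv :: "('a, 'b::euclidean_space) chart set \<Rightarrow> 'a \<Rightarrow> ('a, 'b) tangent \<Rightarrow>
    ('a \<Rightarrow> real) \<Rightarrow> real" where
  "dir_deriv A p v h = (let c = chart_at A p in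
     frechet_derivative (h \<circ> chart_inv c) (at (snd c p)) (v c))"

definition differential :: "('a, 'b::euclidean_space) chart set \<Rightarrow> ('c, 'd::euclidean_space) chart set \<Rightarrow>
    ('a \<Rightarrow> 'c) \<Rightarrow> 'a \<Rightarrow> ('a, 'b) tangent \<Rightarrow> ('c, 'd) tangent" where
  "differential A B F p v = (\<lambda>d. if d \<in> B \<and> F p \<in> fst d
     then (let c = chart_at A p in
       frechet_derivative (snd d \<circ> F \<circ> chart_inv c) (at (snd c p)) (v c))
     else 0)"

type_synonym ('a, 'b) vfield = "'a \<Rightarrow> ('a, 'b) tangent"

definition smooth_vfield :: "('a, 'b::euclidean_space) chart set \<Rightarrow> ('a, 'b) vfield \<Rightarrow> bool" where
  "smooth_vfield A X \<longleftrightarrow> (\<forall>p. X p \<in> tangent_space A p) \<and>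
     (\<forall>c\<in>A. smooth_on (snd c ` fst c) (\<lambda>y. X (chart_inv c y) c))"

text \<open>In every chart, \<open>[X, Y] = DY(X) - DX(Y)\<close>.\<close>
definition lie_bracket ::
  "('a, 'b::euclidean_space) chart set \<Rightarrow> ('a, 'b) vfield \<Rightarrow> ('a, 'b) vfield \<Rightarrow> ('a, 'b) vfield" where
  "lie_bracket A X Y p = (\<lambda>c. if c \<in> A \<and> p \<in> fst c
     then frechet_derivative (\<lambda>y. Y (chart_inv c y) c) (at (snd c p)) (X p c)
        - frechet_derivative (\<lambda>y. X (chart_inv c y) c) (at (snd c p)) (Y p c)
     else 0)"

section \<open>Riemannian metrics and the Levi-Civita connection\<close>

definition linear_on_space ::
  "'v::real_vector set \<Rightarrow> ('v \<Rightarrow> 'w::real_vector) \<Rightarrow> bool" where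
  "linear_on_space T L \<longleftrightarrow>
     (\<forall>v\<in>T. \<forall>w\<in>T. \<forall>a b. L (a *\<^sub>R v + b *\<^sub>R w) = a *\<^sub>R L v + b *\<^sub>R L w)"

type_synonym ('a, 'b) metric = "'a \<Rightarrow> ('a, 'b) tangent \<Rightarrow> ('a, 'b) tangent \<Rightarrow> real"

definition riemannian_metric :: "('a, 'b::euclidean_space) chart set \<Rightarrow> ('a, 'b) metric \<Rightarrow> bool" where
  "riemannian_metric A g \<longleftrightarrow>
     (\<forall>p. \<forall>v\<in>tangent_space A p.
        linear_on_space (tangent_space A p) (g p v) \<and>
        (\<forall>w\<in>tangent_space A p. g p v w = g p w v) \<and>
        (v \<noteq> 0 \<longrightarrow> g p v v > 0)) \<and>
     (\<forall>X Y. smooth_vfield A X \<longrightarrow> smooth_vfield A Y \<longrightarrow> smooth_fun A (\<lambda>p. g p (X p) (Y p)))"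

definition affine_connection :: "('a, 'b::euclidean_space) chart set \<Rightarrow>
    (('a, 'b) vfield \<Rightarrow> ('a, 'b) vfield \<Rightarrow> ('a, 'b) vfield) \<Rightarrow> bool" where
  "affine_connection A D \<longleftrightarrow>
     (\<forall>X Y. smooth_vfield A X \<longrightarrow> smooth_vfield A Y \<longrightarrow> smooth_vfield A (D X Y)) \<and>
     (\<forall>X Y Z h k. smooth_vfield A X \<longrightarrow> smooth_vfield A Y \<longrightarrow> smooth_vfield A Z \<longrightarrow>
        smooth_fun A h \<longrightarrow> smooth_fun A k \<longrightarrow>
        D (\<lambda>p. h p *\<^sub>R X p + k p *\<^sub>R Y p) Z = (\<lambda>p. h p *\<^sub>R D X Z p + k p *\<^sub>R D Y Z p)) \<and>
     (\<forall>X Y Z. smooth_vfield A X \<longrightarrow> smooth_vfield A Y \<longrightarrow> smooth_vfield A Z \<longrightarrow>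
        D X (\<lambda>p. Y p + Z p) = (\<lambda>p. D X Y p + D X Z p)) \<and>
     (\<forall>X Y h. smooth_vfield A X \<longrightarrow> smooth_vfield A Y \<longrightarrow> smooth_fun A h \<longrightarrow>
        D X (\<lambda>p. h p *\<^sub>R Y p) = (\<lambda>p. dir_deriv A p (X p) h *\<^sub>R Y p + h p *\<^sub>R D X Y p))"

definition levi_civita :: "('a, 'b::euclidean_space) chart set \<Rightarrow> ('a, 'b) metric \<Rightarrow>
    (('a, 'b) vfield \<Rightarrow> ('a, 'b) vfield \<Rightarrow> ('a, 'b) vfield) \<Rightarrow> bool" where
  "levi_civita A g D \<longleftrightarrow> affine_connection A D \<and>
     (\<forall>X Y. smooth_vfield A X \<longrightarrow> smooth_vfield A Y \<longrightarrow>
        (\<lambda>p. D X Y p - D Y X p) = lie_bracket A X Y) \<and>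
     (\<forall>X Y Z p. smooth_vfield A X \<longrightarrow> smooth_vfield A Y \<longrightarrow> smooth_vfield A Z \<longrightarrow>
        dir_deriv A p (X p) (\<lambda>q. g q (Y q) (Z q)) = g p (D X Y p) (Z p) + g p (Y p) (D X Z p))"

section \<open>Almost contact metric and Kenmotsu structures\<close>

definition tensor11 :: "('a, 'b::euclidean_space) chart set \<Rightarrow>
    ('a \<Rightarrow> ('a, 'b) tangent \<Rightarrow> ('a, 'b) tangent) \<Rightarrow> bool" where
  "tensor11 A \<phi> \<longleftrightarrow>
     (\<forall>p. \<phi> p ` tangent_space A p \<subseteq> tangent_space A p \<and>
          linear_on_space (tangent_space A p) (\<phi> p)) \<and>
     (\<forall>X. smooth_vfield A X \<longrightarrow> smooth_vfield A (\<lambda>p. \<phi> p (X p)))"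

definition one_form :: "('a, 'b::euclidean_space) chart set \<Rightarrow>
    ('a \<Rightarrow> ('a, 'b) tangent \<Rightarrow> real) \<Rightarrow> bool" where
  "one_form A \<eta> \<longleftrightarrow>
     (\<forall>p. linear_on_space (tangent_space A p) (\<eta> p)) \<and>
     (\<forall>X. smooth_vfield A X \<longrightarrow> smooth_fun A (\<lambda>p. \<eta> p (X p)))"

definition almost_contact_metric :: "('a, 'b::euclidean_space) chart set \<Rightarrow>
    ('a \<Rightarrow> ('a, 'b) tangent \<Rightarrow> ('a, 'b) tangent) \<Rightarrow> ('a, 'b) vfield \<Rightarrow>
    ('a \<Rightarrow> ('a, 'b) tangent \<Rightarrow> real) \<Rightarrow> ('a, 'b) metric \<Rightarrow> bool" where
  "almost_contact_metric A \<phi> \<xi> \<eta> g \<longleftrightarrow>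
     tensor11 A \<phi> \<and> smooth_vfield A \<xi> \<and> one_form A \<eta> \<and> riemannian_metric A g \<and>
     (\<forall>p. \<eta> p (\<xi> p) = 1 \<and> \<phi> p (\<xi> p) = 0) \<and>
     (\<forall>p. \<forall>X\<in>tangent_space A p.
        \<phi> p (\<phi> p X) = - X + \<eta> p X *\<^sub>R \<xi> p \<and>
        \<eta> p (\<phi> p X) = 0 \<and>
        g p X (\<xi> p) = \<eta> p X \<and>
        (\<forall>Y\<in>tangent_space A p.
           g p X Y = g p (\<phi> p X) (\<phi> p Y) + \<eta> p X * \<eta> p Y \<and>
           g p X (\<phi> p Y) = - g p (\<phi> p X) Y))"

text \<open>\<open>D\<close> is the Levi-Civita connection of \<open>g\<close>, and \<open>(D\<^sub>X \<phi>) Y = D\<^sub>X (\<phi> Y) - \<phi> (D\<^sub>X Y)\<close>.\<close>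
definition kenmotsu :: "('a, 'b::euclidean_space) chart set \<Rightarrow>
    ('a \<Rightarrow> ('a, 'b) tangent \<Rightarrow> ('a, 'b) tangent) \<Rightarrow> ('a, 'b) vfield \<Rightarrow>
    ('a \<Rightarrow> ('a, 'b) tangent \<Rightarrow> real) \<Rightarrow> ('a, 'b) metric \<Rightarrow>
    (('a, 'b) vfield \<Rightarrow> ('a, 'b) vfield \<Rightarrow> ('a, 'b) vfield) \<Rightarrow> bool" where
  "kenmotsu A \<phi> \<xi> \<eta> g D \<longleftrightarrow> almost_contact_metric A \<phi> \<xi> \<eta> g \<and> levi_civita A g D \<and>
     (\<forall>X Y p. smooth_vfield A X \<longrightarrow> smooth_vfield A Y \<longrightarrow>
        D X (\<lambda>q. \<phi> q (Y q)) p - \<phi> p (D X Y p)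
          = g p (\<phi> p (X p)) (Y p) *\<^sub>R \<xi> p - \<eta> p (Y p) *\<^sub>R \<phi> p (X p))"

section \<open>Submanifolds\<close>

text \<open>Submanifolds are given by an immersion \<open>j\<close> of a manifold with atlas \<open>B\<close>.\<close>

definition immersion :: "('a::topological_space, 'b::euclidean_space) chart set \<Rightarrow>
    ('c::topological_space, 'd::euclidean_space) chart set \<Rightarrow> ('a \<Rightarrow> 'c) \<Rightarrow> bool" where
  "immersion B A j \<longleftrightarrow> smooth_map B A j \<and>
     (\<forall>p. inj_on (differential B A j p) (tangent_space B p))"

definition tangent_image :: "('a, 'b::euclidean_space) chart set \<Rightarrow>
    ('c, 'd::euclidean_space) chart set \<Rightarrow> ('a \<Rightarrow> 'c) \<Rightarrow> 'a \<Rightarrow> ('c, 'd) tangent set" where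
  "tangent_image B A j p = differential B A j p ` tangent_space B p"

definition normal_tangent_space :: "('a, 'b::euclidean_space) chart set \<Rightarrow>
    ('c, 'd::euclidean_space) chart set \<Rightarrow> ('c, 'd) metric \<Rightarrow> ('a \<Rightarrow> 'c) \<Rightarrow> 'a \<Rightarrow>
    ('c, 'd) tangent set" where
  "normal_tangent_space B A g j p =
     {v \<in> tangent_space A (j p). \<forall>w\<in>tangent_image B A j p. g (j p) v w = 0}"

definition anti_invariant_submanifold :: "('a::topological_space, 'b::euclidean_space) chart set \<Rightarrow>
    ('c::topological_space, 'd::euclidean_space) chart set \<Rightarrow>
    ('c \<Rightarrow> ('c, 'd) tangent \<Rightarrow> ('c, 'd) tangent) \<Rightarrow> ('c, 'd) metric \<Rightarrow> ('a \<Rightarrow> 'c) \<Rightarrow> bool" where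
  "anti_invariant_submanifold B A \<phi> g j \<longleftrightarrow> immersion B A j \<and>
     (\<forall>p. \<phi> (j p) ` tangent_image B A j p \<subseteq> normal_tangent_space B A g j p)"

definition vec_angle :: "('a, 'b) metric \<Rightarrow> 'a \<Rightarrow> ('a, 'b) tangent \<Rightarrow> ('a, 'b) tangent \<Rightarrow> real" where
  "vec_angle g p v w = arccos (g p v w / (sqrt (g p v v) * sqrt (g p w w)))"

text \<open>
  The least angle between \<open>v\<close> and a nonzero vector of \<open>W\<close>; it is the angle between \<open>v\<close> and its
  orthogonal projection to \<open>W\<close>, or \<open>pi / 2\<close> if that projection is \<open>0\<close>.
\<close>
definition angle_to_subspace :: "('a, 'b::real_vector) metric \<Rightarrow> 'a \<Rightarrow> ('a, 'b) tangent \<Rightarrow>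
    ('a, 'b) tangent set \<Rightarrow> real" where
  "angle_to_subspace g p v W = (INF w\<in>W - {0}. vec_angle g p v w)"

definition slant_submanifold :: "('a::topological_space, 'b::euclidean_space) chart set \<Rightarrow>
    ('c::topological_space, 'd::euclidean_space) chart set \<Rightarrow>
    ('c \<Rightarrow> ('c, 'd) tangent \<Rightarrow> ('c, 'd) tangent) \<Rightarrow> ('c, 'd) vfield \<Rightarrow> ('c, 'd) metric \<Rightarrow>
    ('a \<Rightarrow> 'c) \<Rightarrow> real \<Rightarrow> bool" where
  "slant_submanifold B A \<phi> \<xi> g j \<theta> \<longleftrightarrow> immersion B A j \<and>
     (\<forall>p. \<forall>X\<in>tangent_image B A j p. X \<noteq> 0 \<longrightarrow> (\<nexists>a. X = a *\<^sub>R \<xi> (j p)) \<longrightarrow>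
        angle_to_subspace g (j p) (\<phi> (j p) X) (tangent_image B A j p) = \<theta>)"

definition proper_slant_submanifold :: "('a::topological_space, 'b::euclidean_space) chart set \<Rightarrow>
    ('c::topological_space, 'd::euclidean_space) chart set \<Rightarrow>
    ('c \<Rightarrow> ('c, 'd) tangent \<Rightarrow> ('c, 'd) tangent) \<Rightarrow> ('c, 'd) vfield \<Rightarrow> ('c, 'd) metric \<Rightarrow>
    ('a \<Rightarrow> 'c) \<Rightarrow> real \<Rightarrow> bool" where
  "proper_slant_submanifold B A \<phi> \<xi> g j \<theta> \<longleftrightarrow>
     slant_submanifold B A \<phi> \<xi> g j \<theta> \<and> \<theta> \<noteq> 0 \<and> \<theta> \<noteq> pi / 2"

section \<open>Warped products\<close>

definition warped_metric :: "('a, 'b::euclidean_space) chart set \<Rightarrow> ('a, 'b) metric \<Rightarrow>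
    ('c, 'd::euclidean_space) chart set \<Rightarrow> ('c, 'd) metric \<Rightarrow> ('a \<Rightarrow> real) \<Rightarrow>
    ('a \<times> 'c, 'b \<times> 'd) metric" where
  "warped_metric B1 g1 B2 g2 f x v w = (let P = product_atlas B1 B2 in
     g1 (fst x) (differential P B1 fst x v) (differential P B1 fst x w) +
     (f (fst x))\<^sup>2 * g2 (snd x) (differential P B2 snd x v) (differential P B2 snd x w))"

text \<open>The subbundle of the tangent bundle of the product formed by the vectors tangent to the first factor.\<close>
definition first_factor_bundle :: "('a, 'b::euclidean_space) chart set \<Rightarrow>
    ('c, 'd::euclidean_space) chart set \<Rightarrow> 'a \<times> 'c \<Rightarrow> ('a \<times> 'c, 'b \<times> 'd) tangent set" where
  "first_factor_bundle B1 B2 x =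
     tangent_image B1 (product_atlas B1 B2) (\<lambda>p. (p, snd x)) (fst x)"

definition warped_product_submanifold ::
  "('a::topological_space, 'b::euclidean_space) chart set \<Rightarrow> ('a, 'b) metric \<Rightarrow>
   ('c::topological_space, 'd::euclidean_space) chart set \<Rightarrow> ('c, 'd) metric \<Rightarrow> ('a \<Rightarrow> real) \<Rightarrow>
   ('m::topological_space, 'e::euclidean_space) chart set \<Rightarrow> ('m, 'e) metric \<Rightarrow>
   ('a \<times> 'c \<Rightarrow> 'm) \<Rightarrow> bool" where
  "warped_product_submanifold B1 g1 B2 g2 f A g j \<longleftrightarrow> (let P = product_atlas B1 B2 in
     smooth_atlas B1 \<and> riemannian_metric B1 g1 \<and> smooth_atlas B2 \<and> riemannian_metric B2 g2 \<and>
     smooth_fun B1 f \<and> (\<forall>p. f p > 0) \<and>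
     immersion P A j \<and>
     (\<forall>x. \<forall>v\<in>tangent_space P x. \<forall>w\<in>tangent_space P x.
        g (j x) (differential P A j x v) (differential P A j x w) = warped_metric B1 g1 B2 g2 f x v w))"

end

theory Submission
  imports Defs
begin

text \<open>
  Put \<open>\<Omega>(X, Y) = g(\<phi> X, Y)\<close>. The Kenmotsu condition gives \<open>d\<Omega> = 2 \<eta> \<and> \<Omega>\<close>, and this identity survives the pullback
  to \<open>M\<close>. There \<open>\<Omega>(Z, _) = 0\<close> for \<open>Z\<close> tangent to \<open>N\<^sub>\<bottom>\<close>, so for \<open>X\<close>, \<open>Y\<close> tangent to \<open>N\<^sub>\<theta>\<close> and constant in product
  coordinates only \<open>Z \<Omega>(X, Y) = 2 \<eta>(Z) \<Omega>(X, Y)\<close> remains. The slant condition says that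
  \<open>\<Omega>(X, Y) \<le> cos \<theta> f\<^sup>2 |X| |Y|\<close>, with the norms of the metric of the second factor, and that for given \<open>X\<close> equality holds for
  some \<open>Y\<close> at the given point. The difference of the two sides is then minimal at that point, hence
  has zero derivative along \<open>Z\<close>, and \<open>2 \<eta>(Z) cos \<theta> f\<^sup>2 = cos \<theta> Z(f\<^sup>2)\<close> with \<open>cos \<theta> \<noteq> 0\<close>.
\<close>

section \<open>Calculus of \<open>Ck_on\<close>\<close>

text \<open>A derivation by the Gauss formula would need an induced connection and extensions of
  fields tangent to \<open>M\<close>, while \<open>j\<close> is only an immersion and
  \<open>D\<close> acts on global ambient fields. An identity between forms avoids this: it is
  checked in a single ambient chart and then pulled back by \<open>j\<close>. The price is twofold.
  Constant coordinate fields must be cut off to become global, which needs bump functions, and the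
  second derivatives of \<open>j\<close> must be shown to be symmetric.

  The factor \<open>f^2\<close> in the slant bound arises as follows. Since \<xi> is tangent to the
  first factor, \<eta> vanishes on vectors tangent to the second; there \<phi> preserves lengths,
  and |\<phi> X| and |Y| each contribute one factor \<open>f\<close>.

  Equality in the bound cannot simply be differentiated: the extremal Y may change from point to
  point, with no control on how. So Y is frozen at its value for the given point. Away from that
  point only the inequality remains, and this suffices for a minimum argument.\<close>

lemma Ck_on_cong:
  assumes "open S" "\<And>x. x \<in> S \<Longrightarrow> f x = g x" "Ck_on k S f"
  shows "Ck_on k S g"
  using assms(2,3)
proof (induction k arbitrary: f g)
  case 0
  then show ?case using continuous_on_cong[of S S f g] by simp
next
  case (Suc k)
  have *: "g differentiable (at x)"
    "frechet_derivative f (at x) = frechet_derivative g (at x)" if "x \<in> S" for x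
  proof -
    have "(f has_derivative frechet_derivative f (at x)) (at x)"
      using Suc.prems(2) that by (simp add: frechet_derivative_works)
    then have "(g has_derivative frechet_derivative f (at x)) (at x)"
      using Suc.prems(1) has_derivative_transform_within_open[OF _ \<open>open S\<close> that] by blast
    then show "g differentiable (at x)" "frechet_derivative f (at x) = frechet_derivative g (at x)"
      by (auto simp: differentiable_def frechet_derivative_at)
  qed
  have "Ck_on k S (\<lambda>x. frechet_derivative g (at x) v)" for v
    by (rule Suc.IH[of "\<lambda>x. frechet_derivative f (at x) v"]) (use * Suc.prems in auto)
  then show ?case using * by simp
qed

text \<open>Lets an explicit formula \<open>f'\<close> stand in for
  \<open>frechet_derivative\<close>, which agrees with it only on \<open>S\<close>;
  \<open>Ck_on_cong\<close> absorbs the difference outside.\<close>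

lemma Ck_on_SucI:
  assumes "open S" and "\<And>x. x \<in> S \<Longrightarrow> (f has_derivative f' x) (at x)"
    and "\<And>v. Ck_on k S (\<lambda>x. f' x v)"
  shows "Ck_on (Suc k) S f"
proof -
  have "Ck_on k S (\<lambda>x. frechet_derivative f (at x) v)" for v
    by (rule Ck_on_cong[OF assms(1) _ assms(3)[of v]]) (metis assms(2) frechet_derivative_at)
  then show ?thesis using assms(2) by (auto simp: differentiable_def)
qed

lemma Ck_on_SucE:
  assumes "Ck_on (Suc k) S f" "x \<in> S"
  shows "(f has_derivative frechet_derivative f (at x)) (at x)"
  using assms by (simp add: frechet_derivative_works)

lemma Ck_on_SucD: "Ck_on (Suc k) S f \<Longrightarrow> Ck_on k S f"
proof (induction k arbitrary: f)
  case 0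
  then show ?case
    by (auto intro!: continuous_at_imp_continuous_on differentiable_imp_continuous_within)
next
  case (Suc k)
  have "Ck_on k S (\<lambda>x. frechet_derivative f (at x) v)" for v
    using Suc.IH Suc.prems by (metis Ck_on.simps(2))
  then show ?case using Suc.prems by simp
qed

text \<open>Differentiability is tested at single points, so the property glues along open covers.
  This is what later joins the two pieces of a cut-off vector field.\<close>

lemma Ck_on_local:
  assumes "\<And>x. x \<in> S \<Longrightarrow> \<exists>T. open T \<and> x \<in> T \<and> Ck_on k T f"
  shows "Ck_on k S f"
  using assms
proof (induction k arbitrary: f)
  case 0
  have "continuous (at x) f" if "x \<in> S" for x
    using 0[OF that] by (auto simp: continuous_on_eq_continuous_at)
  then show ?case by (auto intro: continuous_at_imp_continuous_on)
next
  case (Suc k)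
  have "Ck_on k S (\<lambda>x. frechet_derivative f (at x) v)" for v
    by (rule Suc.IH) (use Suc.prems in fastforce)
  then show ?case using Suc.prems by fastforce
qed

lemma Ck_on_const: "open S \<Longrightarrow> Ck_on k S (\<lambda>x. c)"
proof (induction k arbitrary: c)
  case (Suc k)
  show ?case by (rule Ck_on_SucI[where f' = "\<lambda>_ _. 0"]) (use Suc in auto)
qed auto

lemma Ck_on_bounded_linear:
  assumes "open S" "bounded_linear f"
  shows "Ck_on k S f"
proof (cases k)
  case 0
  then show ?thesis using assms(2) linear_continuous_on by simp blast
next
  case (Suc l)
  show ?thesis unfolding Suc
    by (rule Ck_on_SucI[where f' = "\<lambda>_. f"])
      (use assms Ck_on_const bounded_linear_imp_has_derivative in auto)
qed

lemma Ck_on_linear_comp: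
  assumes "open S" "bounded_linear L" "Ck_on k S f"
  shows "Ck_on k S (\<lambda>x. L (f x))"
  using assms(3)
proof (induction k arbitrary: f)
  case 0
  then show ?case using assms(2) bounded_linear.continuous_on by auto
next
  case (Suc k)
  show ?case
  proof (rule Ck_on_SucI[OF assms(1)])
    show "Ck_on k S (\<lambda>x. L (frechet_derivative f (at x) v))" for v
      using Suc by simp
  next
    fix x assume "x \<in> S"
    then show "((\<lambda>x. L (f x)) has_derivative (\<lambda>v. L (frechet_derivative f (at x) v))) (at x)"
      by (intro bounded_linear.has_derivative[OF assms(2)] Ck_on_SucE[OF Suc.prems])
  qed
qed

lemma Ck_on_add:
  assumes "open S" "Ck_on k S f" "Ck_on k S g"
  shows "Ck_on k S (\<lambda>x. f x + g x)"
  using assms(2,3)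
proof (induction k arbitrary: f g)
  case 0
  then show ?case by (auto intro: continuous_intros)
next
  case (Suc k)
  show ?case
  proof (rule Ck_on_SucI[OF assms(1)])
    show "Ck_on k S (\<lambda>x. frechet_derivative f (at x) v + frechet_derivative g (at x) v)" for v
      using Suc by simp
  next
    fix x assume "x \<in> S"
    then show "((\<lambda>x. f x + g x) has_derivative
        (\<lambda>v. frechet_derivative f (at x) v + frechet_derivative g (at x) v)) (at x)"
      by (intro has_derivative_add Ck_on_SucE[OF Suc.prems(1)] Ck_on_SucE[OF Suc.prems(2)])
  qed
qed

lemma Ck_on_sum:
  assumes "open S" "\<And>i. i \<in> I \<Longrightarrow> Ck_on k S (f i)"
  shows "Ck_on k S (\<lambda>x. \<Sum>i\<in>I. f i x)"
  using assms(2) by (induction I rule: infinite_finite_induct)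
    (auto intro: Ck_on_const[OF assms(1)] Ck_on_add[OF assms(1)])

lemma Ck_on_bilinear:
  assumes "bounded_bilinear b" "open S" "Ck_on k S f" "Ck_on k S g"
  shows "Ck_on k S (\<lambda>x. b (f x) (g x))"
  using assms(3,4)
proof (induction k arbitrary: f g)
  case 0
  then show ?case using assms(1) by (auto intro: bounded_bilinear.continuous_on)
next
  case (Suc k)
  show ?case
  proof (rule Ck_on_SucI[OF \<open>open S\<close>])
    show "Ck_on k S (\<lambda>x. b (f x) (frechet_derivative g (at x) v)
        + b (frechet_derivative f (at x) v) (g x))" for v
      by (intro Ck_on_add[OF \<open>open S\<close>] Suc.IH Suc.prems[THEN Ck_on_SucD])
        (use Suc.prems in auto)
  next
    fix x assume x: "x \<in> S"
    show "((\<lambda>x. b (f x) (g x)) has_derivative (\<lambda>v. b (f x) (frechet_derivative g (at x) v)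
        + b (frechet_derivative f (at x) v) (g x))) (at x)"
      using bounded_bilinear.FDERIV[OF assms(1) Ck_on_SucE[OF Suc.prems(1) x] Ck_on_SucE[OF Suc.prems(2) x]] .
  qed
qed

lemma Ck_on_inverse:
  fixes f :: "'a::euclidean_space \<Rightarrow> real"
  assumes "open S" "Ck_on k S f" "\<And>x. x \<in> S \<Longrightarrow> f x \<noteq> 0"
  shows "Ck_on k S (\<lambda>x. inverse (f x))"
  using assms(2)
proof (induction k)
  case 0
  then show ?case using assms(3) by (auto intro: continuous_intros)
next
  case (Suc k)
  have IH: "Ck_on k S (\<lambda>x. inverse (f x))" using Suc Ck_on_SucD by blast
  show ?case
  proof (rule Ck_on_SucI[OF \<open>open S\<close>])
    have "Ck_on k S (\<lambda>x. inverse (f x) * frechet_derivative f (at x) v * inverse (f x))" for v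
      by (intro Ck_on_bilinear[OF bounded_bilinear_mult \<open>open S\<close>] IH) (use Suc.prems in auto)
    then show "Ck_on k S (\<lambda>x. - (inverse (f x) * frechet_derivative f (at x) v * inverse (f x)))" for v
      using Ck_on_linear_comp[OF \<open>open S\<close> bounded_linear_minus[OF bounded_linear_ident]] by blast
  next
    fix x assume x: "x \<in> S"
    show "((\<lambda>x. inverse (f x)) has_derivative
        (\<lambda>v. - (inverse (f x) * frechet_derivative f (at x) v * inverse (f x)))) (at x)"
      by (rule Deriv.has_derivative_inverse[OF assms(3)[OF x] Ck_on_SucE[OF Suc.prems x]])
  qed
qed

lemma Ck_on_compose:
  fixes f :: "'b::euclidean_space \<Rightarrow> 'c::real_normed_vector" and g :: "'a::euclidean_space \<Rightarrow> 'b"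
  assumes "open S" "open T" "g ` S \<subseteq> T" "Ck_on k T f" "Ck_on k S g"
  shows "Ck_on k S (\<lambda>x. f (g x))"
  using assms(4,5)
proof (induction k arbitrary: f)
  case 0
  then show ?case using assms(3) continuous_on_compose2 by auto
next
  case (Suc k)
  let ?f' = "\<lambda>y. frechet_derivative f (at y)" and ?g' = "\<lambda>x. frechet_derivative g (at x)"
  have lin: "linear (?f' y)" if "y \<in> T" for y
    using Ck_on_SucE[OF Suc.prems(1) that] has_derivative_linear by blast
  show ?case
  proof (rule Ck_on_SucI[OF \<open>open S\<close>])
    \<comment> \<open>In the chain rule the direction \<open>?g' x v\<close> moves with
      \<open>x\<close>, and the induction hypothesis only covers fixed directions. Expanding it in
      the basis leaves products of class k functions with the fixed directions
      \<open>b\<close>.\<close>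
    show "Ck_on k S (\<lambda>x. \<Sum>b\<in>Basis. (?g' x v \<bullet> b) *\<^sub>R ?f' (g x) b)" for v
      by (intro Ck_on_sum[OF \<open>open S\<close>] Ck_on_bilinear[OF bounded_bilinear_scaleR \<open>open S\<close>]
          Ck_on_linear_comp[OF \<open>open S\<close> bounded_linear_inner_left] Suc.IH Suc.prems(2)[THEN Ck_on_SucD])
        (use Suc.prems in auto)
  next
    fix x assume x: "x \<in> S"
    then have gx: "g x \<in> T" using assms(3) by auto
    have eq: "?f' (g x) w = (\<Sum>b\<in>Basis. (w \<bullet> b) *\<^sub>R ?f' (g x) b)" for w
      by (subst euclidean_representation[of w, symmetric])
        (simp add: linear_sum[OF lin[OF gx]] linear_scale[OF lin[OF gx]])
    have "((\<lambda>x. f (g x)) has_derivative (\<lambda>v. ?f' (g x) (?g' x v))) (at x)"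
      using has_derivative_compose[OF Ck_on_SucE[OF Suc.prems(2) x] Ck_on_SucE[OF Suc.prems(1) gx]] .
    then show "((\<lambda>x. f (g x)) has_derivative (\<lambda>v. \<Sum>b\<in>Basis. (?g' x v \<bullet> b) *\<^sub>R ?f' (g x) b)) (at x)"
      by (simp only: eq[symmetric])
  qed
qed

section \<open>A smooth bump function\<close>

text \<open>For \<open>n = 0\<close> the flat function \<open>exp (- 1 / t)\<close>; the other \<open>n\<close> make the family closed under
  differentiation up to linear combinations.\<close>
definition flat :: "nat \<Rightarrow> real \<Rightarrow> real" where
  "flat n t = (if t > 0 then (1 / t) ^ n * exp (- (1 / t)) else 0)"

text \<open>As \<open>flat n 0 = 0\<close>, this is the difference quotient at 0; it settles the
  only point where the two branches of \<open>flat\<close> meet.\<close>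

lemma flat_over_t_tendsto_0: "((\<lambda>t. flat n t / t) \<longlongrightarrow> 0) (at 0)"
proof -
  have lim: "((\<lambda>t. flat n t / t) \<longlongrightarrow> 0) (at_right 0)"
  proof (rule Lim_transform_eventually)
    have "((\<lambda>t::real. (1 / t) ^ Suc n / exp (1 / t)) \<longlongrightarrow> 0) (at_right 0)"
      using filterlim_compose[OF tendsto_power_div_exp_0[of "Suc n"] filterlim_inverse_at_top_right]
      by (simp add: inverse_eq_divide)
    then show "((\<lambda>t::real. (1 / t) ^ Suc n * exp (- (1 / t))) \<longlongrightarrow> 0) (at_right 0)"
      by (simp add: exp_minus divide_inverse)
    show "\<forall>\<^sub>F t in at_right 0. (1 / t) ^ Suc n * exp (- (1 / t)) = flat n t / t"
      unfolding eventually_at_right_field by (auto simp: flat_def intro!: exI[of _ 1])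
  qed
  moreover have "((\<lambda>t. flat n t / t) \<longlongrightarrow> 0) (at_left 0)"
    by (rule Lim_transform_eventually[OF tendsto_const])
      (auto simp: eventually_at_left_field flat_def intro!: exI[of _ "-1"])
  ultimately show ?thesis using filterlim_split_at by blast
qed

lemma flat_has_real_derivative:
  "(flat n has_real_derivative flat (n + 2) t - real n * flat (Suc n) t) (at t)"
proof -
  consider "t > 0" | "t < 0" | "t = 0" by linarith
  then show ?thesis
  proof cases
    case 1
    \<comment> \<open>For n = 0 the truncated exponent \<open>n - 1\<close> does no harm, because
      its term carries the factor \<open>real n\<close>.\<close>
    have "((\<lambda>t. (1 / t) ^ n * exp (- (1 / t))) has_real_derivative
        real n * (1 / t) ^ (n - 1) * (- ((1 / t) * (1 / t))) * exp (- (1 / t))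
        + (1 / t) ^ n * (exp (- (1 / t)) * ((1 / t) * (1 / t)))) (at t)"
      using 1 by (auto intro!: derivative_eq_intros)
    also have "real n * (1 / t) ^ (n - 1) * (- ((1 / t) * (1 / t))) * exp (- (1 / t))
        + (1 / t) ^ n * (exp (- (1 / t)) * ((1 / t) * (1 / t))) = flat (n + 2) t - real n * flat (Suc n) t"
      using 1 by (cases n) (simp_all add: flat_def algebra_simps add_divide_distrib)
    finally have "((\<lambda>t. (1 / t) ^ n * exp (- (1 / t))) has_real_derivative
        flat (n + 2) t - real n * flat (Suc n) t) (at t)" .
    then show ?thesis
      by (rule has_field_derivative_transform_within_open[where S = "{0<..}"]) (use 1 in \<open>auto simp: flat_def\<close>)
  next
    case 2
    have "((\<lambda>t. 0) has_real_derivative flat (n + 2) t - real n * flat (Suc n) t) (at t)"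
      using 2 by (auto simp: flat_def)
    then show ?thesis
      by (rule has_field_derivative_transform_within_open[where S = "{..<0}"]) (use 2 in \<open>auto simp: flat_def\<close>)
  next
    case 3
    then show ?thesis using flat_over_t_tendsto_0[of n] by (simp add: has_field_derivative_iff flat_def)
  qed
qed

lemma Ck_on_flat: "Ck_on k UNIV (flat n)"
proof (induction k arbitrary: n)
  case 0
  show ?case using DERIV_isCont[OF flat_has_real_derivative]
    by (auto intro!: continuous_at_imp_continuous_on)
next
  case (Suc k)
  show ?case
  proof (rule Ck_on_SucI[OF open_UNIV])
    show "Ck_on k UNIV (\<lambda>t. v * flat (n + 2) t + (- v * real n) * flat (Suc n) t)" for v
      by (intro Ck_on_add Ck_on_linear_comp[OF _ bounded_linear_mult_right] Suc) auto
    show "(flat n has_derivative (\<lambda>v. v * flat (n + 2) t + (- v * real n) * flat (Suc n) t)) (at t)" for t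
      using flat_has_real_derivative[of n t] unfolding has_field_derivative_def
      by (rule has_derivative_eq_rhs) (simp add: fun_eq_iff algebra_simps)
  qed
qed

text \<open>The quotient p / (p + q), where p is positive exactly inside radius r and q exactly
  outside radius r/2. These two regions cover the space, so the denominator never vanishes.\<close>

lemma smooth_bump:
  fixes y0 :: "'e::euclidean_space"
  assumes "r > 0"
  obtains \<beta> :: "'e \<Rightarrow> real" and \<epsilon> where "\<And>k. Ck_on k UNIV \<beta>" "\<epsilon> > 0"
    "\<And>y. dist y0 y < \<epsilon> \<Longrightarrow> \<beta> y = 1" "\<And>y. dist y0 y \<ge> r \<Longrightarrow> \<beta> y = 0"
proof -
  \<comment> \<open>The squared distance, because the distance itself is not differentiable at
    \<open>y0\<close>.\<close>
  define s where "s = (\<lambda>y::'e. (y - y0) \<bullet> (y - y0))"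
  define p where "p = (\<lambda>y. flat 0 (r\<^sup>2 - s y))"
  define q where "q = (\<lambda>y. flat 0 (s y - (r / 2)\<^sup>2))"
  have s: "s y = (dist y0 y)\<^sup>2" for y
    unfolding dist_commute[of y0] by (simp add: s_def dist_norm power2_norm_eq_inner)
  have aff: "Ck_on k UNIV (\<lambda>y. y + (- y0))" for k
    by (intro Ck_on_add Ck_on_const Ck_on_bounded_linear) auto
  have Cs: "Ck_on k UNIV s" for k
    unfolding s_def using Ck_on_bilinear[OF bounded_bilinear_inner open_UNIV aff aff] by simp
  have Cms: "Ck_on k UNIV (\<lambda>y. - s y)" for k
    using Ck_on_linear_comp[OF open_UNIV bounded_linear_minus[OF bounded_linear_ident] Cs] .
  have Cp: "Ck_on k UNIV p" for k
    unfolding p_def using Ck_on_compose[OF open_UNIV open_UNIV _ Ck_on_flat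
        Ck_on_add[OF open_UNIV Ck_on_const Cms]] by simp
  have Cq: "Ck_on k UNIV q" for k
    unfolding q_def using Ck_on_compose[OF open_UNIV open_UNIV _ Ck_on_flat
        Ck_on_add[OF open_UNIV Cs Ck_on_const[of _ _ "- (r / 2)\<^sup>2"]]] by simp
  have nn: "p y \<ge> 0" "q y \<ge> 0" for y by (auto simp: p_def q_def flat_def)
  have rr: "(r / 2)\<^sup>2 < r\<^sup>2" using assms by (intro power_strict_mono) auto
  have pos: "p y + q y \<noteq> 0" for y
  proof (cases "s y < r\<^sup>2")
    case True
    then have "p y > 0" by (simp add: p_def flat_def)
    then show ?thesis using nn(2)[of y] by linarith
  next
    case False
    then have "q y > 0" using rr by (simp add: q_def flat_def)
    then show ?thesis using nn(1)[of y] by linarith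
  qed
  show ?thesis
  proof (rule that[of "\<lambda>y. p y * inverse (p y + q y)" "r / 2"])
    show "Ck_on k UNIV (\<lambda>y. p y * inverse (p y + q y))" for k
      by (intro Ck_on_bilinear[OF bounded_bilinear_mult] Ck_on_inverse Ck_on_add Cp Cq pos) auto
    show "r / 2 > 0" using assms by simp
    show "p y * inverse (p y + q y) = 1" if "dist y0 y < r / 2" for y
    proof -
      have "s y \<le> (r / 2)\<^sup>2" unfolding s using that by (intro power_mono) auto
      then have "q y = 0" by (simp add: q_def flat_def)
      then show ?thesis using pos[of y] by simp
    qed
    show "p y * inverse (p y + q y) = 0" if "dist y0 y \<ge> r" for y
    proof -
      have "s y \<ge> r\<^sup>2" unfolding s using that assms by (intro power_mono) auto
      then show ?thesis by (simp add: p_def flat_def)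
    qed
  qed
qed

section \<open>Charts and tangent vectors\<close>

lemma atlas_chart:
  assumes "smooth_atlas A" "c \<in> A"
  shows "open (fst c)" "open (snd c ` fst c)"
    "homeomorphism (fst c) (snd c ` fst c) (snd c) (chart_inv c)"
  using assms unfolding smooth_atlas_def by auto

lemma atlas_cover:
  assumes "smooth_atlas A"
  obtains c where "c \<in> A" "p \<in> fst c"
  using assms unfolding smooth_atlas_def by blast

lemma chart_at:
  assumes "smooth_atlas A"
  shows "chart_at A p \<in> A" "p \<in> fst (chart_at A p)"
proof -
  obtain c where "c \<in> A \<and> p \<in> fst c" using atlas_cover[OF assms] by blast
  then have "chart_at A p \<in> A \<and> p \<in> fst (chart_at A p)" unfolding chart_at_def by (rule someI)
  then show "chart_at A p \<in> A" "p \<in> fst (chart_at A p)" by auto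
qed

lemma chart_inv_chart [simp]:
  "smooth_atlas A \<Longrightarrow> c \<in> A \<Longrightarrow> p \<in> fst c \<Longrightarrow> chart_inv c (snd c p) = p"
  using homeomorphism_apply1[OF atlas_chart(3)] by blast

lemma chart_image_open:
  assumes "smooth_atlas A" "c \<in> A" "open U"
  shows "open (snd c ` (fst c \<inter> U))"
proof -
  have "openin (top_of_set (snd c ` fst c)) (snd c ` (fst c \<inter> U))"
    using homeomorphism_imp_open_map[OF atlas_chart(3)[OF assms(1,2)]] assms(3)
    by (metis openin_open)
  then show ?thesis using atlas_chart(2)[OF assms(1,2)] openin_open_trans by blast
qed

lemma atlas_transition_smooth:
  assumes "smooth_atlas A" "c \<in> A" "d \<in> A"
  shows "smooth_on (snd c ` (fst c \<inter> fst d)) (snd d \<circ> chart_inv c)"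
  using assms unfolding smooth_atlas_def by blast

lemma smooth_on_imp_differentiable:
  assumes "smooth_on S f" "x \<in> S"
  shows "f differentiable (at x)"
proof -
  have "Ck_on (Suc 0) S f" using assms by (simp only: smooth_on_def)
  then show ?thesis using assms(2) by simp
qed

text \<open>First-order regularity is all that tangent maps and the chain rule require, and it is
  easier to verify than smoothness for slices and projections.\<close>

definition diff_map :: "('a::topological_space, 'b::euclidean_space) chart set \<Rightarrow>
    ('c::topological_space, 'd::euclidean_space) chart set \<Rightarrow> ('a \<Rightarrow> 'c) \<Rightarrow> bool" where
  "diff_map A B F \<longleftrightarrow> continuous_on UNIV F \<and>
     (\<forall>p. \<forall>c\<in>A. \<forall>d\<in>B. p \<in> fst c \<longrightarrow> F p \<in> fst d \<longrightarrow>
        (snd d \<circ> F \<circ> chart_inv c) differentiable (at (snd c p)))"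

lemma smooth_map_imp_diff_map:
  assumes "smooth_map A B F"
  shows "diff_map A B F"
  unfolding diff_map_def
proof (intro conjI allI ballI impI)
  show "continuous_on UNIV F" using assms by (simp add: smooth_map_def)
  fix p c d assume "c \<in> A" "d \<in> B" "p \<in> fst c" "F p \<in> fst d"
  then show "(snd d \<circ> F \<circ> chart_inv c) differentiable (at (snd c p))"
    using assms unfolding smooth_map_def
    by (intro smooth_on_imp_differentiable[of "snd c ` (fst c \<inter> F -` fst d)"]) auto
qed

lemma diff_map_deriv:
  assumes "diff_map A B F" "c \<in> A" "d \<in> B" "p \<in> fst c" "F p \<in> fst d"
  shows "(snd d \<circ> F \<circ> chart_inv c has_derivative
    frechet_derivative (snd d \<circ> F \<circ> chart_inv c) (at (snd c p))) (at (snd c p))"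
  using assms by (simp add: diff_map_def frechet_derivative_works)

lemma diff_map_id:
  assumes "smooth_atlas A"
  shows "diff_map A A id"
  unfolding diff_map_def
proof (intro conjI allI ballI impI)
  show "continuous_on UNIV id" by simp
  fix p c d assume *: "c \<in> A" "d \<in> A" "p \<in> fst c" "id p \<in> fst d"
  show "(snd d \<circ> id \<circ> chart_inv c) differentiable (at (snd c p))"
    using smooth_on_imp_differentiable[OF atlas_transition_smooth[OF assms *(1,2)], of "snd c p"] *
    by simp
qed

lemma transition_deriv:
  assumes "smooth_atlas A" "c \<in> A" "d \<in> A" "p \<in> fst c" "p \<in> fst d"
  shows "(snd d \<circ> chart_inv c has_derivative
    frechet_derivative (snd d \<circ> chart_inv c) (at (snd c p))) (at (snd c p))"
  using diff_map_deriv[OF diff_map_id[OF assms(1)] assms(2,3,4)] assms(5) by simp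

text \<open>The coordinate composite through \<open>d\<close> represents \<open>H \<circ> F\<close>
  only near \<open>p\<close>, on the part of \<open>c\<close> that \<open>F\<close> sends into
  \<open>d\<close>; continuity of \<open>F\<close> makes this part open. With \<open>F = id\<close>
  the lemma gives independence of the chart.\<close>

lemma has_derivative_through_chart:
  assumes A: "smooth_atlas A" and B: "smooth_atlas B" and F: "continuous_on UNIV F"
    and c: "c \<in> A" "p \<in> fst c" and d: "d \<in> B" "F p \<in> fst d"
    and L: "(snd d \<circ> F \<circ> chart_inv c has_derivative L) (at (snd c p))"
    and M: "(H \<circ> chart_inv d has_derivative M) (at (snd d (F p)))"
  shows "(H \<circ> F \<circ> chart_inv c has_derivative M \<circ> L) (at (snd c p))"
proof -
  let ?S = "snd c ` (fst c \<inter> F -` fst d)"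
  have "open (F -` fst d)"
    using F atlas_chart(1)[OF B d(1)] by (simp add: continuous_on_open_vimage)
  then have S: "open ?S" by (rule chart_image_open[OF A c(1)])
  have "(\<lambda>y. (H \<circ> chart_inv d) ((snd d \<circ> F \<circ> chart_inv c) y)) y = (H \<circ> F \<circ> chart_inv c) y"
    if "y \<in> ?S" for y
    using that A B c d by auto
  moreover have "((\<lambda>y. (H \<circ> chart_inv d) ((snd d \<circ> F \<circ> chart_inv c) y)) has_derivative
      (\<lambda>h. M (L h))) (at (snd c p))"
    by (rule has_derivative_compose[OF L]) (use M A c in \<open>simp add: comp_def\<close>)
  ultimately show ?thesis
    using has_derivative_transform_within_open[OF _ S, of _ "\<lambda>h. M (L h)" "snd c p" UNIV] c d
    by (auto simp: comp_def)
qed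

lemma diff_map_comp:
  assumes A: "smooth_atlas A" and B: "smooth_atlas B" and F: "diff_map A B F" and G: "diff_map B C G"
  shows "diff_map A C (G \<circ> F)"
  unfolding diff_map_def
proof (intro conjI allI ballI impI)
  have cF: "continuous_on UNIV F" using F by (simp add: diff_map_def)
  then show "continuous_on UNIV (G \<circ> F)"
    by (rule continuous_on_compose)
      (use G continuous_on_subset[of UNIV G] in \<open>auto simp: diff_map_def\<close>)
  fix p c e assume *: "c \<in> A" "e \<in> C" "p \<in> fst c" "(G \<circ> F) p \<in> fst e"
  obtain d where d: "d \<in> B" "F p \<in> fst d" using atlas_cover[OF B] by blast
  have "(snd e \<circ> G \<circ> F \<circ> chart_inv c has_derivative
      frechet_derivative (snd e \<circ> G \<circ> chart_inv d) (at (snd d (F p))) \<circ>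
      frechet_derivative (snd d \<circ> F \<circ> chart_inv c) (at (snd c p))) (at (snd c p))"
    by (rule has_derivative_through_chart[OF A B cF *(1,3) d diff_map_deriv[OF F *(1) d(1) *(3) d(2)]
          diff_map_deriv[OF G d(1) *(2) d(2)]]) (use * in simp)
  then show "(snd e \<circ> (G \<circ> F) \<circ> chart_inv c) differentiable (at (snd c p))"
    by (auto simp: differentiable_def o_assoc)
qed

section \<open>Tangent vectors and tangent maps in coordinates\<close>

lemma tangent_spaceD:
  assumes "v \<in> tangent_space A p" "c \<in> A" "d \<in> A" "p \<in> fst c" "p \<in> fst d"
  shows "v d = frechet_derivative (snd d \<circ> chart_inv c) (at (snd c p)) (v c)"
  using assms unfolding tangent_space_def by blast

lemma tangent_space_off:
  assumes "v \<in> tangent_space A p" "\<not> (c \<in> A \<and> p \<in> fst c)"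
  shows "v c = 0"
  using assms unfolding tangent_space_def by blast

text \<open>The transition rule fixes the components in all other charts around \<open>p\<close>,
  and the remaining indices hold 0. Equalities of tangent vectors are thus reduced to one convenient
  chart.\<close>

lemma tangent_eqI:
  assumes "v \<in> tangent_space A p" "w \<in> tangent_space A p" "c \<in> A" "p \<in> fst c" "v c = w c"
  shows "v = w"
proof
  fix d
  show "v d = w d"
  proof (cases "d \<in> A \<and> p \<in> fst d")
    case True
    then show ?thesis
      using tangent_spaceD[OF assms(1,3) _ assms(4), of d] tangent_spaceD[OF assms(2,3) _ assms(4), of d]
        assms(5) by simp
  next
    case False
    then show ?thesis using tangent_space_off[OF assms(1)] tangent_space_off[OF assms(2)] by simp
  qed
qed

lemma tangent_space_lincomb:
  assumes A: "smooth_atlas A" and v: "v \<in> tangent_space A p" and w: "w \<in> tangent_space A p"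
  shows "a *\<^sub>R v + b *\<^sub>R w \<in> tangent_space A p"
  unfolding tangent_space_def
proof (intro CollectI conjI allI impI ballI)
  show "(a *\<^sub>R v + b *\<^sub>R w) c = 0" if "\<not> (c \<in> A \<and> p \<in> fst c)" for c
    using tangent_space_off[OF v that] tangent_space_off[OF w that]
    by (simp add: scaleR_fun_def)
  fix c d assume *: "c \<in> A" "d \<in> A" "p \<in> fst c \<inter> fst d"
  have "linear (frechet_derivative (snd d \<circ> chart_inv c) (at (snd c p)))"
    using transition_deriv[OF A *(1,2)] * has_derivative_linear by auto
  then show "(a *\<^sub>R v + b *\<^sub>R w) d =
      frechet_derivative (snd d \<circ> chart_inv c) (at (snd c p)) ((a *\<^sub>R v + b *\<^sub>R w) c)"
    using tangent_spaceD[OF v *(1,2)] tangent_spaceD[OF w *(1,2)] *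
    by (simp add: scaleR_fun_def linear_add linear_scale)
qed

lemma tangent_space_zero: "smooth_atlas A \<Longrightarrow> 0 \<in> tangent_space A p"
  unfolding tangent_space_def
  by (auto dest: transition_deriv has_derivative_linear linear_0)

text \<open>For fixed \<open>u\<close> and varying \<open>p\<close> this is the coordinate field
  with constant components \<open>u\<close> in the chart \<open>c\<close>; all later computations
  are done in such frames.\<close>

definition tangent_of_coords ::
  "('a, 'b::euclidean_space) chart set \<Rightarrow> ('a, 'b) chart \<Rightarrow> 'a \<Rightarrow> 'b \<Rightarrow> ('a, 'b) tangent" where
  "tangent_of_coords A c p u = (\<lambda>d. if d \<in> A \<and> p \<in> fst d
     then frechet_derivative (snd d \<circ> chart_inv c) (at (snd c p)) u else 0)"

lemma chart_self_deriv:
  assumes "smooth_atlas A" "c \<in> A" "p \<in> fst c"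
  shows "(snd c \<circ> chart_inv c has_derivative (\<lambda>h. h)) (at (snd c p))"
  by (rule has_derivative_transform_within_open[OF has_derivative_ident atlas_chart(2)[OF assms(1,2)]])
    (use assms in auto)

lemma tangent_of_coords_self [simp]:
  assumes "smooth_atlas A" "c \<in> A" "p \<in> fst c"
  shows "tangent_of_coords A c p u c = u"
  using frechet_derivative_at[OF chart_self_deriv[OF assms], symmetric] assms
  by (simp add: tangent_of_coords_def)

lemma tangent_of_coords_in:
  assumes A: "smooth_atlas A" and c: "c \<in> A" "p \<in> fst c"
  shows "tangent_of_coords A c p u \<in> tangent_space A p"
  unfolding tangent_space_def
proof (intro CollectI conjI allI impI ballI)
  fix d e assume *: "d \<in> A" "e \<in> A" "p \<in> fst d \<inter> fst e"
  have "(snd e \<circ> id \<circ> chart_inv c has_derivative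
      frechet_derivative (snd e \<circ> chart_inv d) (at (snd d p)) \<circ>
      frechet_derivative (snd d \<circ> chart_inv c) (at (snd c p))) (at (snd c p))"
    by (rule has_derivative_through_chart[OF A A _ c, of id d])
      (use * c transition_deriv[OF A c(1) *(1) c(2)] transition_deriv[OF A *(1,2)] in auto)
  from fun_cong[OF frechet_derivative_at[OF this]] show "tangent_of_coords A c p u e =
      frechet_derivative (snd e \<circ> chart_inv d) (at (snd d p)) (tangent_of_coords A c p u d)"
    using * by (simp add: tangent_of_coords_def)
qed (auto simp: tangent_of_coords_def)

lemma tangent_of_coords_eq:
  assumes "smooth_atlas A" "c \<in> A" "p \<in> fst c" "v \<in> tangent_space A p"
  shows "tangent_of_coords A c p (v c) = v"
  by (rule tangent_eqI[OF tangent_of_coords_in[OF assms(1-3)] assms(4) assms(2,3)]) (use assms in simp)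

lemma tangent_of_coords_lincomb:
  assumes "smooth_atlas A" "c \<in> A" "p \<in> fst c"
  shows "tangent_of_coords A c p (a *\<^sub>R u + b *\<^sub>R w)
    = a *\<^sub>R tangent_of_coords A c p u + b *\<^sub>R tangent_of_coords A c p w"
  by (rule tangent_eqI[OF tangent_of_coords_in tangent_space_lincomb])
    (use assms in \<open>auto simp: tangent_of_coords_in scaleR_fun_def\<close>)

text \<open>Frees the tangent map from the arbitrary chart \<open>chart_at A p\<close> in its
  definition: the transition rule for \<open>v\<close> and the chain rule cancel the change of
  chart.\<close>

lemma differential_chart:
  assumes A: "smooth_atlas A" and F: "diff_map A B F" and v: "v \<in> tangent_space A p"
    and c: "c \<in> A" "p \<in> fst c" and d: "d \<in> B" "F p \<in> fst d"
  shows "differential A B F p v d = frechet_derivative (snd d \<circ> F \<circ> chart_inv c) (at (snd c p)) (v c)"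
proof -
  define c0 where "c0 = chart_at A p"
  have c0: "c0 \<in> A" "p \<in> fst c0" using chart_at[OF A] by (auto simp: c0_def)
  have "(snd d \<circ> F \<circ> id \<circ> chart_inv c0 has_derivative
      frechet_derivative (snd d \<circ> F \<circ> chart_inv c) (at (snd c p)) \<circ>
      frechet_derivative (snd c \<circ> chart_inv c0) (at (snd c0 p))) (at (snd c0 p))"
    by (rule has_derivative_through_chart[OF A A _ c0, of id c])
      (use c transition_deriv[OF A c0(1) c(1) c0(2) c(2)] diff_map_deriv[OF F c(1) d(1) c(2) d(2)] in auto)
  from fun_cong[OF frechet_derivative_at[OF this]] show ?thesis
    using d tangent_spaceD[OF v c0(1) c(1) c0(2) c(2)]
    by (simp add: differential_def Let_def c0_def[symmetric])
qed

lemma differential_in: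
  assumes A: "smooth_atlas A" and B: "smooth_atlas B" and F: "diff_map A B F"
    and v: "v \<in> tangent_space A p"
  shows "differential A B F p v \<in> tangent_space B (F p)"
  unfolding tangent_space_def
proof (intro CollectI conjI allI impI ballI)
  fix d e assume *: "d \<in> B" "e \<in> B" "F p \<in> fst d \<inter> fst e"
  obtain c where c: "c \<in> A" "p \<in> fst c" using atlas_cover[OF A] by blast
  have "(snd e \<circ> F \<circ> chart_inv c has_derivative
      frechet_derivative (snd e \<circ> chart_inv d) (at (snd d (F p))) \<circ>
      frechet_derivative (snd d \<circ> F \<circ> chart_inv c) (at (snd c p))) (at (snd c p))"
    by (rule has_derivative_through_chart[OF A B _ c])
      (use * F diff_map_deriv[OF F c(1) *(1) c(2)] transition_deriv[OF B *(1,2)] in \<open>auto simp: diff_map_def\<close>)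
  from fun_cong[OF frechet_derivative_at[OF this]] show "differential A B F p v e =
      frechet_derivative (snd e \<circ> chart_inv d) (at (snd d (F p))) (differential A B F p v d)"
    using * by (simp add: differential_chart[OF A F v c])
qed (auto simp: differential_def)

lemma differential_lincomb:
  assumes A: "smooth_atlas A" and F: "diff_map A B F"
    and v: "v \<in> tangent_space A p" and w: "w \<in> tangent_space A p"
  shows "differential A B F p (a *\<^sub>R v + b *\<^sub>R w)
    = a *\<^sub>R differential A B F p v + b *\<^sub>R differential A B F p w"
proof
  fix d
  obtain c where c: "c \<in> A" "p \<in> fst c" using atlas_cover[OF A] by blast
  show "differential A B F p (a *\<^sub>R v + b *\<^sub>R w) d
    = (a *\<^sub>R differential A B F p v + b *\<^sub>R differential A B F p w) d"
  proof (cases "d \<in> B \<and> F p \<in> fst d")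
    case True
    then have "linear (frechet_derivative (snd d \<circ> F \<circ> chart_inv c) (at (snd c p)))"
      using diff_map_deriv[OF F c(1) _ c(2)] has_derivative_linear by blast
    then show ?thesis using True
      differential_chart[OF A F tangent_space_lincomb[OF A v w] c]
      by (simp add: differential_chart[OF A F v c] differential_chart[OF A F w c] scaleR_fun_def
          linear_add linear_scale)
  qed (auto simp: differential_def scaleR_fun_def)
qed

lemma differential_comp:
  assumes A: "smooth_atlas A" and B: "smooth_atlas B" and F: "diff_map A B F" and G: "diff_map B C G"
    and v: "v \<in> tangent_space A p"
  shows "differential B C G (F p) (differential A B F p v) = differential A C (G \<circ> F) p v"
proof
  fix e
  obtain c where c: "c \<in> A" "p \<in> fst c" using atlas_cover[OF A] by blast
  obtain d where d: "d \<in> B" "F p \<in> fst d" using atlas_cover[OF B] by blast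
  show "differential B C G (F p) (differential A B F p v) e = differential A C (G \<circ> F) p v e"
  proof (cases "e \<in> C \<and> G (F p) \<in> fst e")
    case True
    have "(snd e \<circ> G \<circ> F \<circ> chart_inv c has_derivative
      frechet_derivative (snd e \<circ> G \<circ> chart_inv d) (at (snd d (F p))) \<circ>
      frechet_derivative (snd d \<circ> F \<circ> chart_inv c) (at (snd c p))) (at (snd c p))"
      using F diff_map_deriv[OF F c(1) d(1) c(2) d(2)] diff_map_deriv[OF G d(1) _ d(2)] True
      by (intro has_derivative_through_chart[where F = F, OF A B _ c d]) (auto simp: diff_map_def)
    from fun_cong[OF frechet_derivative_at[OF this]] True show ?thesis
      by (simp add: differential_chart[OF B G differential_in[OF A B F v] d]
          differential_chart[OF A F v c] d differential_chart[OF A diff_map_comp[OF A B F G] v c]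
          o_assoc)
  qed (auto simp: differential_def)
qed

lemma differential_id:
  assumes "smooth_atlas A" "v \<in> tangent_space A p"
  shows "differential A A id p v = v"
proof
  fix d
  obtain c where c: "c \<in> A" "p \<in> fst c" using atlas_cover[OF assms(1)] by blast
  show "differential A A id p v d = v d"
    using differential_chart[OF assms(1) diff_map_id[OF assms(1)] assms(2) c, of d]
      tangent_spaceD[OF assms(2) c(1) _ c(2), of d] tangent_space_off[OF assms(2), of d]
    by (cases "d \<in> A \<and> p \<in> fst d") (auto simp: differential_def)
qed

lemma differential_const: "differential A B (\<lambda>_. k) p v = 0"
  by (auto simp: differential_def Let_def comp_def fun_eq_iff)

section \<open>Product atlases\<close>

lemma product_atlasI:
  "c1 \<in> B1 \<Longrightarrow> c2 \<in> B2 \<Longrightarrow> (fst c1 \<times> fst c2, map_prod (snd c1) (snd c2)) \<in> product_atlas B1 B2"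
  unfolding product_atlas_def by blast

lemma product_atlasE:
  assumes "c \<in> product_atlas B1 B2"
  obtains c1 c2 where "c1 \<in> B1" "c2 \<in> B2" "c = (fst c1 \<times> fst c2, map_prod (snd c1) (snd c2))"
  using assms by (auto simp: product_atlas_def)

lemma product_chart_inv:
  assumes "smooth_atlas B1" "smooth_atlas B2" "c1 \<in> B1" "c2 \<in> B2"
    and y: "y \<in> snd c1 ` fst c1 \<times> snd c2 ` fst c2"
  shows "inv_into (fst c1 \<times> fst c2) (map_prod (snd c1) (snd c2)) y
    = (chart_inv c1 (fst y), chart_inv c2 (snd y))"
proof -
  obtain p q where y: "y = (snd c1 p, snd c2 q)" "p \<in> fst c1" "q \<in> fst c2" using y by auto
  have "inj_on (snd c1) (fst c1)" "inj_on (snd c2) (fst c2)"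
    using assms by (metis chart_inv_chart inj_on_inverseI)+
  then have "inj_on (map_prod (snd c1) (snd c2)) (fst c1 \<times> fst c2)"
    by (rule map_prod_inj_on)
  from inv_into_f_f[OF this, of "(p, q)"] show ?thesis using y assms by simp
qed

lemma smooth_atlas_product:
  assumes B1: "smooth_atlas B1" and B2: "smooth_atlas B2"
  shows "smooth_atlas (product_atlas B1 B2)"
  unfolding smooth_atlas_def
proof (intro conjI ballI)
  show "(\<Union>c\<in>product_atlas B1 B2. fst c) = UNIV"
  proof (intro equalityI subsetI UNIV_I)
    fix x :: "'a \<times> 'c"
    obtain c1 c2 where "c1 \<in> B1" "fst x \<in> fst c1" "c2 \<in> B2" "snd x \<in> fst c2"
      using atlas_cover[OF B1] atlas_cover[OF B2] by metis
    then show "x \<in> (\<Union>c\<in>product_atlas B1 B2. fst c)"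
      using product_atlasI[of c1 B1 c2 B2] by (force simp: mem_Times_iff)
  qed
  fix c assume "c \<in> product_atlas B1 B2"
  then obtain c1 c2 where c: "c1 \<in> B1" "c2 \<in> B2" "c = (fst c1 \<times> fst c2, map_prod (snd c1) (snd c2))"
    by (rule product_atlasE)
  note op = atlas_chart[OF B1 c(1)] atlas_chart[OF B2 c(2)]
  have im: "snd c ` fst c = snd c1 ` fst c1 \<times> snd c2 ` fst c2"
    using c by (simp add: map_prod_surj_on)
  have inv: "chart_inv c y = (chart_inv c1 (fst y), chart_inv c2 (snd y))" if "y \<in> snd c ` fst c" for y
    using product_chart_inv[OF B1 B2 c(1,2), of y] that unfolding im by (simp add: c(3))
  show "open (fst c)" "open (snd c ` fst c)" unfolding im using op c by (auto intro: open_Times)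
  show "homeomorphism (fst c) (snd c ` fst c) (snd c) (chart_inv c)"
  proof
    have "continuous_on (fst c1) (snd c1)" "continuous_on (fst c2) (snd c2)"
      using op by (auto simp: homeomorphism_def)
    then have "continuous_on (fst c1 \<times> fst c2) (\<lambda>x. (snd c1 (fst x), snd c2 (snd x)))"
      by (intro continuous_on_Pair continuous_on_compose2[OF _ continuous_on_fst[OF continuous_on_id]]
          continuous_on_compose2[OF _ continuous_on_snd[OF continuous_on_id]]) auto
    then show "continuous_on (fst c) (snd c)"
      unfolding c(3) fst_conv snd_conv by (rule continuous_on_eq) auto
    have "continuous_on (snd c1 ` fst c1) (chart_inv c1)" "continuous_on (snd c2 ` fst c2) (chart_inv c2)"
      using op by (auto simp: homeomorphism_def)
    then have "continuous_on (snd c1 ` fst c1 \<times> snd c2 ` fst c2)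
        (\<lambda>y. (chart_inv c1 (fst y), chart_inv c2 (snd y)))"
      by (intro continuous_on_Pair continuous_on_compose2[OF _ continuous_on_fst[OF continuous_on_id]]
          continuous_on_compose2[OF _ continuous_on_snd[OF continuous_on_id]]) auto
    then show "continuous_on (snd c ` fst c) (chart_inv c)"
      unfolding im[symmetric] by (rule continuous_on_eq) (simp add: inv)
    show "snd c ` fst c \<subseteq> snd c ` fst c" by simp
    show "chart_inv c ` snd c ` fst c \<subseteq> fst c"
      using inv_into_into[of _ "snd c" "fst c"] by blast
    show "chart_inv c (snd c x) = x" if "x \<in> fst c" for x
      using that inv[OF imageI[OF that]] c B1 B2 by (auto simp: mem_Times_iff)
    show "snd c (chart_inv c y) = y" if "y \<in> snd c ` fst c" for y
      using that by (rule f_inv_into_f)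
  qed
  fix d assume "d \<in> product_atlas B1 B2"
  then obtain d1 d2 where d: "d1 \<in> B1" "d2 \<in> B2" "d = (fst d1 \<times> fst d2, map_prod (snd d1) (snd d2))"
    by (rule product_atlasE)
  let ?T1 = "snd c1 ` (fst c1 \<inter> fst d1)" and ?T2 = "snd c2 ` (fst c2 \<inter> fst d2)"
  let ?t1 = "snd d1 \<circ> chart_inv c1" and ?t2 = "snd d2 \<circ> chart_inv c2"
  have im': "snd c ` (fst c \<inter> fst d) = ?T1 \<times> ?T2"
    using c d by (auto simp: Times_Int_Times map_prod_surj_on)
  have o1: "open ?T1" using chart_image_open[OF B1 c(1) atlas_chart(1)[OF B1 d(1)]] .
  have o2: "open ?T2" using chart_image_open[OF B2 c(2) atlas_chart(1)[OF B2 d(2)]] .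
  have o: "open (?T1 \<times> ?T2)" using o1 o2 by (rule open_Times)
  show "smooth_on (snd c ` (fst c \<inter> fst d)) (snd d \<circ> chart_inv c)"
    unfolding smooth_on_def im'
  proof
    fix k
    have 1: "Ck_on k (?T1 \<times> ?T2) (\<lambda>y. ?t1 (fst y))"
      by (rule Ck_on_compose[OF o o1 _ _ Ck_on_bounded_linear[OF o bounded_linear_fst]])
        (use atlas_transition_smooth[OF B1 c(1) d(1)] in \<open>auto simp: smooth_on_def comp_def\<close>)
    have 2: "Ck_on k (?T1 \<times> ?T2) (\<lambda>y. ?t2 (snd y))"
      by (rule Ck_on_compose[OF o o2 _ _ Ck_on_bounded_linear[OF o bounded_linear_snd]])
        (use atlas_transition_smooth[OF B2 c(2) d(2)] in \<open>auto simp: smooth_on_def comp_def\<close>)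
    \<comment> \<open>The pair of transition maps is written as a sum of two linear embeddings, so
      that the rules for linear maps and sums apply.\<close>
    have l1: "bounded_linear (\<lambda>x::'b. (x, 0::'d))" and l2: "bounded_linear (\<lambda>x::'d. (0::'b, x))"
      by (auto intro: bounded_linear_Pair bounded_linear_ident bounded_linear_zero)
    show "Ck_on k (?T1 \<times> ?T2) (snd d \<circ> chart_inv c)"
    proof (rule Ck_on_cong[OF o _ Ck_on_add[OF o Ck_on_linear_comp[OF o l1 1] Ck_on_linear_comp[OF o l2 2]]])
      fix y assume "y \<in> ?T1 \<times> ?T2"
      then have "y \<in> snd c ` fst c" unfolding im by auto
      from inv[OF this] show "(?t1 (fst y), 0) + (0, ?t2 (snd y)) = (snd d \<circ> chart_inv c) y"
        using d by simp
    qed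
  qed
qed

lemma product_slice_maps:
  assumes B1: "smooth_atlas B1" and B2: "smooth_atlas B2"
  shows diff_map_left_slice: "diff_map B1 (product_atlas B1 B2) (\<lambda>p. (p, q))"
    and diff_map_right_slice: "diff_map B2 (product_atlas B1 B2) (\<lambda>q. (p, q))"
proof -
  show "diff_map B1 (product_atlas B1 B2) (\<lambda>p. (p, q))"
    unfolding diff_map_def
  proof (intro conjI allI ballI impI)
    fix p c d assume *: "c \<in> B1" "d \<in> product_atlas B1 B2" "p \<in> fst c" "(p, q) \<in> fst d"
    obtain d1 d2 where d: "d1 \<in> B1" "d2 \<in> B2" "d = (fst d1 \<times> fst d2, map_prod (snd d1) (snd d2))"
      using *(2) by (rule product_atlasE)
    have "((\<lambda>y. ((snd d1 \<circ> chart_inv c) y, snd d2 q)) has_derivative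
       (\<lambda>h. (frechet_derivative (snd d1 \<circ> chart_inv c) (at (snd c p)) h, 0))) (at (snd c p))"
      by (intro has_derivative_Pair transition_deriv[OF B1] has_derivative_const) (use * d in auto)
    then show "snd d \<circ> (\<lambda>p. (p, q)) \<circ> chart_inv c differentiable at (snd c p)"
      unfolding differentiable_def d by (auto simp: comp_def)
  qed (intro continuous_intros)
  show "diff_map B2 (product_atlas B1 B2) (\<lambda>q. (p, q))"
    unfolding diff_map_def
  proof (intro conjI allI ballI impI)
    fix q c d assume *: "c \<in> B2" "d \<in> product_atlas B1 B2" "q \<in> fst c" "(p, q) \<in> fst d"
    obtain d1 d2 where d: "d1 \<in> B1" "d2 \<in> B2" "d = (fst d1 \<times> fst d2, map_prod (snd d1) (snd d2))"
      using *(2) by (rule product_atlasE)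
    have "((\<lambda>y. (snd d1 p, (snd d2 \<circ> chart_inv c) y)) has_derivative
       (\<lambda>h. (0, frechet_derivative (snd d2 \<circ> chart_inv c) (at (snd c q)) h))) (at (snd c q))"
      by (intro has_derivative_Pair transition_deriv[OF B2] has_derivative_const) (use * d in auto)
    then show "snd d \<circ> (\<lambda>q. (p, q)) \<circ> chart_inv c differentiable at (snd c q)"
      unfolding differentiable_def d by (auto simp: comp_def)
  qed (intro continuous_intros)
qed

lemma diff_map_projections:
  assumes B1: "smooth_atlas B1" and B2: "smooth_atlas B2"
  shows diff_map_fst: "diff_map (product_atlas B1 B2) B1 fst"
    and diff_map_snd: "diff_map (product_atlas B1 B2) B2 snd"
proof -
  have op: "open (snd c ` fst c)" if "c \<in> product_atlas B1 B2" for c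
    using atlas_chart(2)[OF smooth_atlas_product[OF B1 B2] that] .
  show "diff_map (product_atlas B1 B2) B1 fst"
    unfolding diff_map_def
  proof (intro conjI allI ballI impI)
    fix x c d assume *: "c \<in> product_atlas B1 B2" "d \<in> B1" "x \<in> fst c" "fst x \<in> fst d"
    obtain c1 c2 where c: "c1 \<in> B1" "c2 \<in> B2" "c = (fst c1 \<times> fst c2, map_prod (snd c1) (snd c2))"
      using *(1) by (rule product_atlasE)
    have x: "fst (snd c x) = snd c1 (fst x)" "fst x \<in> fst c1" using * c by (cases x; auto)+
    then obtain L where "(snd d \<circ> chart_inv c1 has_derivative L) (at (fst (snd c x)))"
      using transition_deriv[OF B1 c(1) *(2) _ *(4)] by auto
    then have "((\<lambda>y. (snd d \<circ> chart_inv c1) (fst y)) has_derivative (\<lambda>h. L (fst h))) (at (snd c x))"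
      by (rule has_derivative_compose[OF has_derivative_fst[OF has_derivative_ident]])
    then have "(snd d \<circ> fst \<circ> chart_inv c has_derivative (\<lambda>h. L (fst h))) (at (snd c x))"
      by (rule has_derivative_transform_within_open[OF _ op[OF *(1)]])
        (use * product_chart_inv[OF B1 B2 c(1,2)] c in \<open>auto simp: map_prod_surj_on\<close>)
    then show "snd d \<circ> fst \<circ> chart_inv c differentiable at (snd c x)"
      by (auto simp: differentiable_def)
  qed (intro continuous_intros)
  show "diff_map (product_atlas B1 B2) B2 snd"
    unfolding diff_map_def
  proof (intro conjI allI ballI impI)
    fix x c d assume *: "c \<in> product_atlas B1 B2" "d \<in> B2" "x \<in> fst c" "snd x \<in> fst d"
    obtain c1 c2 where c: "c1 \<in> B1" "c2 \<in> B2" "c = (fst c1 \<times> fst c2, map_prod (snd c1) (snd c2))"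
      using *(1) by (rule product_atlasE)
    have x: "snd (snd c x) = snd c2 (snd x)" "snd x \<in> fst c2" using * c by (cases x; auto)+
    then obtain L where "(snd d \<circ> chart_inv c2 has_derivative L) (at (snd (snd c x)))"
      using transition_deriv[OF B2 c(2) *(2) _ *(4)] by auto
    then have "((\<lambda>y. (snd d \<circ> chart_inv c2) (snd y)) has_derivative (\<lambda>h. L (snd h))) (at (snd c x))"
      by (rule has_derivative_compose[OF has_derivative_snd[OF has_derivative_ident]])
    then have "(snd d \<circ> snd \<circ> chart_inv c has_derivative (\<lambda>h. L (snd h))) (at (snd c x))"
      by (rule has_derivative_transform_within_open[OF _ op[OF *(1)]])
        (use * product_chart_inv[OF B1 B2 c(1,2)] c in \<open>auto simp: map_prod_surj_on\<close>)
    then show "snd d \<circ> snd \<circ> chart_inv c differentiable at (snd c x)"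
      by (auto simp: differentiable_def)
  qed (intro continuous_intros)
qed

text \<open>Links the geometric splitting to coordinates: vectors tangent to the first factor are
  those with coordinates \<open>(z, 0)\<close>, vectors tangent to the second those with
  \<open>(0, w)\<close>.\<close>

lemma tangent_of_coords_product:
  assumes B1: "smooth_atlas B1" and B2: "smooth_atlas B2" and c: "c1 \<in> B1" "c2 \<in> B2"
    and pq: "p \<in> fst c1" "q \<in> fst c2"
  defines "c \<equiv> (fst c1 \<times> fst c2, map_prod (snd c1) (snd c2))"
  shows tangent_of_coords_left: "tangent_of_coords (product_atlas B1 B2) c (p, q) (z, 0)
      = differential B1 (product_atlas B1 B2) (\<lambda>p. (p, q)) p (tangent_of_coords B1 c1 p z)"
    and tangent_of_coords_right: "tangent_of_coords (product_atlas B1 B2) c (p, q) (0, w)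
      = differential B2 (product_atlas B1 B2) (\<lambda>q. (p, q)) q (tangent_of_coords B2 c2 q w)"
proof -
  let ?P = "product_atlas B1 B2"
  have P: "smooth_atlas ?P" by (rule smooth_atlas_product[OF B1 B2])
  have cP: "c \<in> ?P" "(p, q) \<in> fst c" using c pq by (auto simp: c_def intro: product_atlasI)
  note t1 = chart_self_deriv[OF B1 c(1) pq(1)] and t2 = chart_self_deriv[OF B2 c(2) pq(2)]
  show "tangent_of_coords ?P c (p, q) (z, 0)
      = differential B1 ?P (\<lambda>p. (p, q)) p (tangent_of_coords B1 c1 p z)"
  proof (rule tangent_eqI[OF tangent_of_coords_in[OF P cP]
        differential_in[OF B1 P diff_map_left_slice[OF B1 B2] tangent_of_coords_in[OF B1 c(1) pq(1)]] cP])
    have "(snd c \<circ> (\<lambda>p. (p, q)) \<circ> chart_inv c1 has_derivative (\<lambda>h. (h, 0))) (at (snd c1 p))"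
      using has_derivative_Pair[OF t1 has_derivative_const] by (simp add: c_def comp_def)
    from fun_cong[OF frechet_derivative_at[OF this]]
    show "tangent_of_coords ?P c (p, q) (z, 0) c
        = differential B1 ?P (\<lambda>p. (p, q)) p (tangent_of_coords B1 c1 p z) c"
      using differential_chart[OF B1 diff_map_left_slice[OF B1 B2] tangent_of_coords_in[OF B1 c(1) pq(1)]
          c(1) pq(1) cP] P cP B1 c pq by simp
  qed
  show "tangent_of_coords ?P c (p, q) (0, w)
      = differential B2 ?P (\<lambda>q. (p, q)) q (tangent_of_coords B2 c2 q w)"
  proof (rule tangent_eqI[OF tangent_of_coords_in[OF P cP]
        differential_in[OF B2 P diff_map_right_slice[OF B1 B2] tangent_of_coords_in[OF B2 c(2) pq(2)]] cP])
    have "(snd c \<circ> (\<lambda>q. (p, q)) \<circ> chart_inv c2 has_derivative (\<lambda>h. (0, h))) (at (snd c2 q))"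
      using has_derivative_Pair[OF has_derivative_const t2] by (simp add: c_def comp_def)
    from fun_cong[OF frechet_derivative_at[OF this]]
    show "tangent_of_coords ?P c (p, q) (0, w) c
        = differential B2 ?P (\<lambda>q. (p, q)) q (tangent_of_coords B2 c2 q w) c"
      using differential_chart[OF B2 diff_map_right_slice[OF B1 B2] tangent_of_coords_in[OF B2 c(2) pq(2)]
          c(2) pq(2) cP] P cP B2 c pq by simp
  qed
qed

section \<open>Locally constant vector fields\<close>

text \<open>The axioms for \<open>D\<close> speak of globally smooth fields only, so a coordinate
  field is multiplied by a bump function and extended by 0. The Hausdorff property enters through
  the support: it lies in a compact set, which is then closed, and so the extension is
  smooth.\<close>

lemma locally_constant_vfield:
  fixes A :: "('m::t2_space, 'e::euclidean_space) chart set"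
  assumes A: "smooth_atlas A" and a: "a \<in> A" "p0 \<in> fst a"
  obtains X N where "smooth_vfield A X" "open N" "snd a p0 \<in> N" "N \<subseteq> snd a ` fst a"
    "\<And>y. y \<in> N \<Longrightarrow> X (chart_inv a y) = tangent_of_coords A a (chart_inv a y) u"
proof -
  let ?O = "snd a ` fst a"
  have O: "open ?O" and hom: "homeomorphism (fst a) ?O (snd a) (chart_inv a)"
    using atlas_chart[OF A a(1)] by auto
  obtain r where r: "r > 0" "cball (snd a p0) r \<subseteq> ?O"
    using O a(2) open_contains_cball by blast
  obtain \<beta> :: "'e \<Rightarrow> real" and \<epsilon> where \<beta>: "\<And>k. Ck_on k UNIV \<beta>" "\<epsilon> > 0"
    "\<And>y. dist (snd a p0) y < \<epsilon> \<Longrightarrow> \<beta> y = 1" "\<And>y. dist (snd a p0) y \<ge> r \<Longrightarrow> \<beta> y = 0"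
    using smooth_bump[OF r(1)] by metis
  define K where "K = chart_inv a ` cball (snd a p0) r"
  have "compact K" unfolding K_def
    by (rule compact_continuous_image[OF _ compact_cball])
      (use hom r continuous_on_subset in \<open>auto simp: homeomorphism_def\<close>)
  then have K: "open (- K)" using compact_imp_closed by blast
  define X where "X = (\<lambda>p. if p \<in> fst a then \<beta> (snd a p) *\<^sub>R tangent_of_coords A a p u else 0)"
  have Xin: "X p \<in> tangent_space A p" for p
  proof (cases "p \<in> fst a")
    case True
    then show ?thesis
      using tangent_space_lincomb[OF A tangent_of_coords_in[OF A a(1) True] tangent_of_coords_in[OF A a(1) True],
          of "\<beta> (snd a p)" u 0 u] by (simp add: X_def)
  qed (simp add: X_def tangent_space_zero[OF A])
  have X0: "X p = 0" if "p \<notin> K" for p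
  proof (cases "p \<in> fst a")
    case True
    then have "dist (snd a p0) (snd a p) > r"
      using that chart_inv_chart[OF A a(1) True] unfolding K_def
      by (metis imageI mem_cball not_le)
    then show ?thesis by (simp add: X_def \<beta>)
  qed (simp add: X_def)
  have Xsm: "smooth_on (snd c ` fst c) (\<lambda>y. X (chart_inv c y) c)" if c: "c \<in> A" for c
    unfolding smooth_on_def
  proof (intro allI Ck_on_local)
    fix k y assume y: "y \<in> snd c ` fst c"
    show "\<exists>T. open T \<and> y \<in> T \<and> Ck_on k T (\<lambda>y. X (chart_inv c y) c)"
    \<comment> \<open>The open sets \<open>fst a\<close> and \<open>- K\<close> cover the manifold.
      On the first the field is given by a formula, on the second it is 0.\<close>
    proof (cases "chart_inv c y \<in> fst a")
      case True
      let ?T = "snd c ` (fst c \<inter> fst a)" and ?S = "snd a ` (fst a \<inter> fst c)"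
      have T: "open ?T" and S: "open ?S"
        using chart_image_open[OF A] c a atlas_chart(1)[OF A] by auto
      have yT: "y \<in> ?T" using y True A c by auto
      have t: "Ck_on k ?T (snd a \<circ> chart_inv c)"
        using atlas_transition_smooth[OF A c a(1)] by (simp add: smooth_on_def)
      have im: "(snd a \<circ> chart_inv c) ` ?T \<subseteq> ?S" using A c a by auto
      \<comment> \<open>One order more than k, because the components in \<open>c\<close> contain
        the derivative of the transition map.\<close>
      have "Ck_on (Suc k) ?S (snd c \<circ> chart_inv a)"
        using atlas_transition_smooth[OF A a(1) c] unfolding smooth_on_def by blast
      then have D: "Ck_on k ?S (\<lambda>y. frechet_derivative (snd c \<circ> chart_inv a) (at y) u)" by simp
      have "Ck_on k ?T (\<lambda>y. \<beta> ((snd a \<circ> chart_inv c) y) *\<^sub>R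
          frechet_derivative (snd c \<circ> chart_inv a) (at ((snd a \<circ> chart_inv c) y)) u)"
        by (intro Ck_on_bilinear[OF bounded_bilinear_scaleR T] Ck_on_compose[OF T open_UNIV _ \<beta>(1) t]
            Ck_on_compose[OF T S im D t]) auto
      then have "Ck_on k ?T (\<lambda>y. X (chart_inv c y) c)"
        by (rule Ck_on_cong[OF T, rotated])
          (use A c a in \<open>auto simp: X_def tangent_of_coords_def scaleR_fun_def\<close>)
      then show ?thesis using T yT by blast
    next
      case False
      let ?T = "snd c ` (fst c \<inter> - K)"
      have T: "open ?T" using chart_image_open[OF A c K] .
      have "K \<subseteq> fst a" using r(2) unfolding K_def by (auto intro!: inv_into_into)
      then have yT: "y \<in> ?T" using y False A c by auto
      have "Ck_on k ?T (\<lambda>y. X (chart_inv c y) c)"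
        by (rule Ck_on_cong[OF T _ Ck_on_const[OF T, of _ 0]]) (use A c X0 in auto)
      then show ?thesis using T yT by blast
    qed
  qed
  show ?thesis
  proof
    show "smooth_vfield A X" unfolding smooth_vfield_def using Xin Xsm by blast
    show "open (ball (snd a p0) \<epsilon> \<inter> ?O)" using O by auto
    show "snd a p0 \<in> ball (snd a p0) \<epsilon> \<inter> ?O" using a \<beta>(2) by auto
    show "X (chart_inv a y) = tangent_of_coords A a (chart_inv a y) u"
      if "y \<in> ball (snd a p0) \<epsilon> \<inter> ?O" for y
      using that \<beta>(3) A a by (auto simp: X_def)
  qed auto
qed

section \<open>The fundamental 2-form of a Kenmotsu manifold\<close>

text \<open>The fundamental 2-form on coordinate vectors. The point comes last, so that fixing
  \<open>u\<close> and \<open>v\<close> leaves a function of the coordinates that can be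
  differentiated.\<close>

definition coord_form :: "('m, 'e::euclidean_space) chart set \<Rightarrow>
    ('m \<Rightarrow> ('m, 'e) tangent \<Rightarrow> ('m, 'e) tangent) \<Rightarrow> ('m, 'e) metric \<Rightarrow> ('m, 'e) chart \<Rightarrow>
    'e \<Rightarrow> 'e \<Rightarrow> 'e \<Rightarrow> real" where
  "coord_form A \<phi> g a u v y = g (chart_inv a y)
     (\<phi> (chart_inv a y) (tangent_of_coords A a (chart_inv a y) u)) (tangent_of_coords A a (chart_inv a y) v)"

section \<open>Pointwise algebra of the metric and of the fundamental form\<close>

lemma metric_lincomb_right:
  assumes "riemannian_metric A g" "u \<in> tangent_space A p" "v \<in> tangent_space A p" "w \<in> tangent_space A p"
  shows "g p u (a *\<^sub>R v + b *\<^sub>R w) = a * g p u v + b * g p u w"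
  using assms unfolding riemannian_metric_def linear_on_space_def by auto

lemma metric_sym:
  assumes "riemannian_metric A g" "u \<in> tangent_space A p" "v \<in> tangent_space A p"
  shows "g p u v = g p v u"
  using assms unfolding riemannian_metric_def by auto

lemma metric_lincomb_left:
  assumes "smooth_atlas A" "riemannian_metric A g"
    "u \<in> tangent_space A p" "v \<in> tangent_space A p" "w \<in> tangent_space A p"
  shows "g p (a *\<^sub>R v + b *\<^sub>R w) u = a * g p v u + b * g p w u"
  using metric_lincomb_right[OF assms(2-5)] metric_sym[OF assms(2,3)] assms
    tangent_space_lincomb[OF assms(1,4,5)] by metis

lemma almost_contact_metricD:
  assumes "almost_contact_metric A \<phi> \<xi> \<eta> g"
  shows "riemannian_metric A g"
    and "smooth_vfield A X \<Longrightarrow> smooth_vfield A (\<lambda>p. \<phi> p (X p))"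
    and "u \<in> tangent_space A p \<Longrightarrow> \<phi> p u \<in> tangent_space A p"
    and "u \<in> tangent_space A p \<Longrightarrow> v \<in> tangent_space A p \<Longrightarrow>
      \<phi> p (a *\<^sub>R u + b *\<^sub>R v) = a *\<^sub>R \<phi> p u + b *\<^sub>R \<phi> p v"
    and "\<xi> p \<in> tangent_space A p"
    and "u \<in> tangent_space A p \<Longrightarrow> g p u (\<xi> p) = \<eta> p u"
    and "u \<in> tangent_space A p \<Longrightarrow> v \<in> tangent_space A p \<Longrightarrow> g p u (\<phi> p v) = - g p (\<phi> p u) v"
    and "u \<in> tangent_space A p \<Longrightarrow> v \<in> tangent_space A p \<Longrightarrow>
      g p u v = g p (\<phi> p u) (\<phi> p v) + \<eta> p u * \<eta> p v"
  using assms unfolding almost_contact_metric_def tensor11_def linear_on_space_def smooth_vfield_def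
  by blast+

lemma coord_form_antisym:
  assumes "smooth_atlas A" "almost_contact_metric A \<phi> \<xi> \<eta> g" "a \<in> A" "y \<in> snd a ` fst a"
  shows "coord_form A \<phi> g a v u y = - coord_form A \<phi> g a u v y"
proof -
  have p: "chart_inv a y \<in> fst a" using assms(4) by (rule inv_into_into)
  show ?thesis unfolding coord_form_def
    using almost_contact_metricD(3,7)[OF assms(2)] metric_sym[OF almost_contact_metricD(1)[OF assms(2)]]
      tangent_of_coords_in[OF assms(1,3) p] by metis
qed

lemma coord_form_bilinear:
  assumes "smooth_atlas A" "almost_contact_metric A \<phi> \<xi> \<eta> g" "a \<in> A" "y \<in> snd a ` fst a"
  shows "bilinear (\<lambda>u v. coord_form A \<phi> g a u v y)"
proof -
  have p: "chart_inv a y \<in> fst a" using assms(4) by (rule inv_into_into)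
  note t = tangent_of_coords_in[OF assms(1,3) p] and lc = tangent_of_coords_lincomb[OF assms(1,3) p]
  note acm = almost_contact_metricD[OF assms(2)]
  have 1: "coord_form A \<phi> g a u (r *\<^sub>R v + s *\<^sub>R w) y
      = r * coord_form A \<phi> g a u v y + s * coord_form A \<phi> g a u w y" for u v w r s
    unfolding coord_form_def lc by (rule metric_lincomb_right[OF acm(1)]) (use t acm(3) in auto)
  \<comment> \<open>Antisymmetry carries linearity over from the second slot to the first.\<close>
  have 2: "coord_form A \<phi> g a (r *\<^sub>R v + s *\<^sub>R w) u y
      = r * coord_form A \<phi> g a v u y + s * coord_form A \<phi> g a w u y" for u v w r s
    using 1[of u r v s w] coord_form_antisym[OF assms, where u = u and v = "r *\<^sub>R v + s *\<^sub>R w"]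
      coord_form_antisym[OF assms, where u = u and v = v] coord_form_antisym[OF assms, where u = u and v = w]
    by simp
  show ?thesis unfolding bilinear_def
  proof (intro conjI allI linearI)
    show "coord_form A \<phi> g a u (v + w) y = coord_form A \<phi> g a u v y + coord_form A \<phi> g a u w y"
      "coord_form A \<phi> g a (v + w) u y = coord_form A \<phi> g a v u y + coord_form A \<phi> g a w u y" for u v w
      using 1[of u 1 v 1 w] 2[of 1 v 1 w u] by simp_all
    show "coord_form A \<phi> g a u (r *\<^sub>R v) y = r *\<^sub>R coord_form A \<phi> g a u v y"
      "coord_form A \<phi> g a (r *\<^sub>R v) u y = r *\<^sub>R coord_form A \<phi> g a v u y" for u v r
      using 1[of u r v 0 v] 2[of r v 0 v u] by simp_all
  qed
qed

text \<open>In coordinates, \<open>d\<Omega> = 2 \<eta> \<and> \<Omega>\<close> for \<open>\<Omega>(X, Y) = g(\<phi> X, Y)\<close>. Since the connection is torsion-free, only the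
  terms coming from the covariant derivative of \<open>\<phi>\<close> survive in the cyclic sum.\<close>
lemma coord_form_exterior_deriv:
  fixes A :: "('m::t2_space, 'e::euclidean_space) chart set" and p :: 'm
  assumes A: "smooth_atlas A" and K: "kenmotsu A \<phi> \<xi> \<eta> g D"
  defines "a \<equiv> chart_at A p"
  defines "y0 \<equiv> snd a p" and "\<Omega> \<equiv> coord_form A \<phi> g a" and "e \<equiv> \<lambda>u. \<eta> p (tangent_of_coords A a p u)"
  shows coord_form_differentiable: "\<Omega> u v differentiable (at y0)"
    and coord_form_cyclic: "frechet_derivative (\<Omega> v w) (at y0) u + frechet_derivative (\<Omega> w u) (at y0) v
      + frechet_derivative (\<Omega> u v) (at y0) w
      = 2 * (e u * \<Omega> v w y0 + e v * \<Omega> w u y0 + e w * \<Omega> u v y0)"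
proof -
  have a: "a \<in> A" "p \<in> fst a" using chart_at[OF A] by (auto simp: a_def)
  have y0: "y0 \<in> snd a ` fst a" "chart_inv a y0 = p" using A a by (auto simp: y0_def)
  have acm: "almost_contact_metric A \<phi> \<xi> \<eta> g" and lc: "levi_civita A g D"
    using K by (auto simp: kenmotsu_def)
  note acmD = almost_contact_metricD[OF acm]
  have "\<exists>X N. smooth_vfield A X \<and> open N \<and> y0 \<in> N \<and> N \<subseteq> snd a ` fst a \<and>
      (\<forall>y\<in>N. X (chart_inv a y) = tangent_of_coords A a (chart_inv a y) u)" for u
    by (rule locally_constant_vfield[OF A a, of u]) (auto simp: y0_def)
  then obtain X N where X: "\<And>u. smooth_vfield A (X u)" and N: "\<And>u. open (N u)" "\<And>u. y0 \<in> N u"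
      "\<And>u. N u \<subseteq> snd a ` fst a"
    and XN: "\<And>u y. y \<in> N u \<Longrightarrow> X u (chart_inv a y) = tangent_of_coords A a (chart_inv a y) u"
    by metis
  have Xp: "X u p = tangent_of_coords A a p u" for u using XN[OF N(2)] y0(2) by simp
  have Xin: "X u p \<in> tangent_space A p" for u using X by (simp add: smooth_vfield_def)
  have Dsm: "smooth_vfield A (D (X u) (X v))" for u v
    using lc X unfolding levi_civita_def affine_connection_def by blast
  define \<Gamma> where "\<Gamma> = (\<lambda>u v. D (X u) (X v) p)"
  have \<Gamma>in: "\<Gamma> u v \<in> tangent_space A p" for u v using Dsm by (simp add: smooth_vfield_def \<Gamma>_def)
  \<comment> \<open>Constant components have zero derivative at \<open>y0\<close>, so the Lie
    brackets of these fields vanish there. Torsion-freeness then makes \<Gamma> symmetric.\<close>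
  have const: "frechet_derivative (\<lambda>y. X u (chart_inv a y) a) (at y0) = (\<lambda>_. 0)" for u
  proof -
    have "((\<lambda>y. X u (chart_inv a y) a) has_derivative (\<lambda>_. 0)) (at y0)"
    proof (rule has_derivative_transform_within_open[OF has_derivative_const N(1)[of u] N(2)])
      fix y assume y: "y \<in> N u"
      then have "y \<in> snd a ` fst a" using N(3) by blast
      then have "chart_inv a y \<in> fst a" by (rule inv_into_into)
      then show "u = X u (chart_inv a y) a" using XN[OF y] A a by simp
    qed
    then show ?thesis by (rule frechet_derivative_at[symmetric])
  qed
  have \<Gamma>sym: "\<Gamma> u v = \<Gamma> v u" for u v
  proof (rule tangent_eqI[OF \<Gamma>in \<Gamma>in a])
    have "(\<lambda>p. D (X u) (X v) p - D (X v) (X u) p) = lie_bracket A (X u) (X v)"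
      using lc X unfolding levi_civita_def by blast
    from fun_cong[OF fun_cong[OF this, of p], of a] show "\<Gamma> u v a = \<Gamma> v u a"
      using a const by (simp add: lie_bracket_def y0_def \<Gamma>_def)
  qed
  have "smooth_fun A (\<lambda>q. g q (\<phi> q (X u q)) (X v q))" for u v
    using acmD(1) acmD(2)[OF X] X unfolding riemannian_metric_def by blast
  then have "smooth_on (snd a ` fst a) ((\<lambda>q. g q (\<phi> q (X u q)) (X v q)) \<circ> chart_inv a)" for u v
    using a unfolding smooth_fun_def by blast
  from smooth_on_imp_differentiable[OF this y0(1)]
  have hd: "((\<lambda>q. g q (\<phi> q (X u q)) (X v q)) \<circ> chart_inv a has_derivative
      frechet_derivative ((\<lambda>q. g q (\<phi> q (X u q)) (X v q)) \<circ> chart_inv a) (at y0)) (at y0)" for u v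
    by (simp add: frechet_derivative_works)
  have \<Omega>d: "(\<Omega> u v has_derivative
      frechet_derivative ((\<lambda>q. g q (\<phi> q (X u q)) (X v q)) \<circ> chart_inv a) (at y0)) (at y0)" for u v
    by (rule has_derivative_transform_within_open[OF hd open_Int[OF N(1)[of u] N(1)[of v]]])
      (use N(2) XN in \<open>auto simp: \<Omega>_def coord_form_def\<close>)
  then show "\<Omega> u v differentiable (at y0)" for u v by (auto simp: differentiable_def)
  \<comment> \<open>Collects all the terms in which the connection itself survives; only its
    symmetry in the last two arguments will matter.\<close>
  define k where "k = (\<lambda>w u v. g p (\<phi> p (X w p)) (\<Gamma> u v))"
  have ksym: "k w u v = k w v u" for u v w using \<Gamma>sym by (simp add: k_def)
  have \<Omega>0: "\<Omega> u v y0 = g p (\<phi> p (X u p)) (X v p)" for u v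
    by (simp add: \<Omega>_def coord_form_def y0(2) Xp)
  have anti: "\<Omega> v u y0 = - \<Omega> u v y0" for u v
    unfolding \<Omega>_def by (rule coord_form_antisym[OF A acm a(1) y0(1)])
  have e: "e u = \<eta> p (X u p)" for u by (simp add: e_def Xp)
  have main: "frechet_derivative (\<Omega> v w) (at y0) u
      = - k w u v + k v u w + \<Omega> u v y0 * e w - e v * \<Omega> u w y0" for u v w
  proof -
    have "frechet_derivative (\<Omega> v w) (at y0) u
        = dir_deriv A p (X u p) (\<lambda>q. g q (\<phi> q (X v q)) (X w q))"
      using frechet_derivative_at[OF \<Omega>d[of v w]] A a
      by (simp add: dir_deriv_def Let_def a_def[symmetric] y0_def Xp)
    also have "\<dots> = g p (D (X u) (\<lambda>q. \<phi> q (X v q)) p) (X w p) + g p (\<phi> p (X v p)) (\<Gamma> u w)"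
      using lc X acmD(2)[OF X] unfolding levi_civita_def \<Gamma>_def by blast
    \<comment> \<open>The Kenmotsu identity solved for the derivative of \<open>\<phi> X\<close>.
      The scalars 1 bring the right side into the form to which \<open>metric_lincomb_left\<close>
      applies.\<close>
    also have "D (X u) (\<lambda>q. \<phi> q (X v q)) p
        = 1 *\<^sub>R \<phi> p (\<Gamma> u v) + 1 *\<^sub>R (\<Omega> u v y0 *\<^sub>R \<xi> p + (- e v) *\<^sub>R \<phi> p (X u p))"
    proof -
      have "D (X u) (\<lambda>q. \<phi> q (X v q)) p - \<phi> p (\<Gamma> u v) = \<Omega> u v y0 *\<^sub>R \<xi> p - e v *\<^sub>R \<phi> p (X u p)"
        using K X unfolding kenmotsu_def \<Gamma>_def \<Omega>0 e by blast
      then show ?thesis by (simp add: algebra_simps)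
    qed
    also have "g p \<dots> (X w p) = g p (\<phi> p (\<Gamma> u v)) (X w p) + \<Omega> u v y0 * g p (\<xi> p) (X w p)
        - e v * g p (\<phi> p (X u p)) (X w p)"
      by (subst metric_lincomb_left[OF A acmD(1)] metric_lincomb_left[OF A acmD(1)];
          (intro Xin acmD(3) acmD(5) \<Gamma>in tangent_space_lincomb[OF A])?)+ simp
    also have "g p (\<phi> p (\<Gamma> u v)) (X w p) = - k w u v"
      using acmD(7)[OF \<Gamma>in Xin, of u v w] metric_sym[OF acmD(1) \<Gamma>in acmD(3)[OF Xin], of u v w]
      by (simp add: k_def)
    also have "g p (\<xi> p) (X w p) = e w"
      using metric_sym[OF acmD(1) acmD(5) Xin] acmD(6)[OF Xin] by (simp add: e)
    finally show ?thesis by (simp add: \<Omega>0 k_def)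
  qed
  \<comment> \<open>In the cyclic sum the terms \<open>k\<close> cancel in pairs by symmetry. By
    antisymmetry of \<Omega> each product of \<eta> with \<Omega> occurs twice, which is the source
    of the factor 2.\<close>
  show "frechet_derivative (\<Omega> v w) (at y0) u + frechet_derivative (\<Omega> w u) (at y0) v
      + frechet_derivative (\<Omega> u v) (at y0) w
      = 2 * (e u * \<Omega> v w y0 + e v * \<Omega> w u y0 + e w * \<Omega> u v y0)"
    unfolding main using ksym[of w u v] ksym[of v u w] ksym[of u v w] anti[of u w] anti[of v u] anti[of w v]
    by (simp add: algebra_simps)
qed

section \<open>Pulling back a 2-form\<close>

lemma has_real_derivative_along_line:
  fixes f :: "'a::real_normed_vector \<Rightarrow> real"
  assumes "(f has_derivative L) (at (x + s *\<^sub>R u))"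
  shows "((\<lambda>s. f (x + s *\<^sub>R u)) has_real_derivative L u) (at s)"
proof -
  have "((\<lambda>s. x + s *\<^sub>R u) has_derivative (\<lambda>h. h *\<^sub>R u)) (at s)"
    by (auto intro!: derivative_eq_intros)
  from has_derivative_compose[OF this assms] show ?thesis
    unfolding has_field_derivative_def
    by (rule has_derivative_eq_rhs)
      (simp add: fun_eq_iff linear_scale[OF has_derivative_linear[OF assms]] mult.commute)
qed

text \<open>Two applications of the mean value theorem: first in s to the increment of
  \<open>f\<close> in direction \<open>v\<close>, then in t to the derivative in direction
  \<open>u\<close>. The left side is symmetric in \<open>u\<close> and \<open>v\<close>, which is
  why it is of use.\<close>

lemma second_difference_mean_value:
  fixes f :: "'a::euclidean_space \<Rightarrow> real"
  assumes f: "Ck_on 2 S f" and h: "h > 0"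
    and S: "\<And>s t. 0 \<le> s \<Longrightarrow> s \<le> h \<Longrightarrow> 0 \<le> t \<Longrightarrow> t \<le> h \<Longrightarrow> x + s *\<^sub>R u + t *\<^sub>R v \<in> S"
  obtains s t where "0 \<le> s" "s \<le> h" "0 \<le> t" "t \<le> h"
    "f (x + h *\<^sub>R u + h *\<^sub>R v) - f (x + h *\<^sub>R u) - f (x + h *\<^sub>R v) + f x
      = h * h * frechet_derivative (\<lambda>y. frechet_derivative f (at y) u) (at (x + s *\<^sub>R u + t *\<^sub>R v)) v"
proof -
  let ?D = "\<lambda>y. frechet_derivative f (at y)"
  let ?E = "\<lambda>y. frechet_derivative (\<lambda>y. ?D y u) (at y)"
  have f': "Ck_on (Suc (Suc 0)) S f" using f by (simp only: numeral_2_eq_2)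
  then have f1: "Ck_on (Suc 0) S f" by (rule Ck_on_SucD)
  have Df1: "Ck_on (Suc 0) S (\<lambda>y. ?D y u)" using f' by (metis Ck_on.simps(2))
  note D = Ck_on_SucE[OF f1] and E = Ck_on_SucE[OF Df1]
  have d1: "((\<lambda>s. f (x + s *\<^sub>R u + h *\<^sub>R v) - f (x + s *\<^sub>R u)) has_real_derivative
      ?D (x + s *\<^sub>R u + h *\<^sub>R v) u - ?D (x + s *\<^sub>R u) u) (at s)" if "0 \<le> s" "s \<le> h" for s
  proof (rule DERIV_diff)
    show "((\<lambda>s. f (x + s *\<^sub>R u)) has_real_derivative ?D (x + s *\<^sub>R u) u) (at s)"
      using S[OF that, of 0] h by (intro has_real_derivative_along_line D) simp
    have "x + h *\<^sub>R v + s *\<^sub>R u \<in> S" using S[OF that, of h] h by (simp add: algebra_simps)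
    from has_real_derivative_along_line[OF D[OF this]]
    show "((\<lambda>s. f (x + s *\<^sub>R u + h *\<^sub>R v)) has_real_derivative ?D (x + s *\<^sub>R u + h *\<^sub>R v) u) (at s)"
      by (simp add: algebra_simps)
  qed
  obtain s where s: "0 < s" "s < h"
    "f (x + h *\<^sub>R u + h *\<^sub>R v) - f (x + h *\<^sub>R u) - (f (x + 0 *\<^sub>R u + h *\<^sub>R v) - f (x + 0 *\<^sub>R u))
      = (h - 0) * (?D (x + s *\<^sub>R u + h *\<^sub>R v) u - ?D (x + s *\<^sub>R u) u)"
    using MVT2[OF h d1] by blast
  have d2: "((\<lambda>t. ?D (x + s *\<^sub>R u + t *\<^sub>R v) u) has_real_derivative ?E (x + s *\<^sub>R u + t *\<^sub>R v) v) (at t)"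
    if "0 \<le> t" "t \<le> h" for t
    using s that by (intro has_real_derivative_along_line E S) auto
  obtain t where t: "0 < t" "t < h"
    "?D (x + s *\<^sub>R u + h *\<^sub>R v) u - ?D (x + s *\<^sub>R u + 0 *\<^sub>R v) u = (h - 0) * ?E (x + s *\<^sub>R u + t *\<^sub>R v) v"
    using MVT2[OF h d2] by blast
  show ?thesis
    by (rule that[of s t]) (use s t in \<open>auto simp: algebra_simps\<close>)
qed

lemma second_derivative_symmetric_real:
  fixes f :: "'a::euclidean_space \<Rightarrow> real"
  assumes S: "open S" and f: "Ck_on 2 S f" and x: "x \<in> S"
  shows "frechet_derivative (\<lambda>y. frechet_derivative f (at y) u) (at x) v
    = frechet_derivative (\<lambda>y. frechet_derivative f (at y) v) (at x) u"
proof (rule ccontr)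
  let ?E = "\<lambda>u v y. frechet_derivative (\<lambda>y. frechet_derivative f (at y) u) (at y) v"
  \<comment> \<open>Half the supposed gap: a number cannot lie within less than \<open>e\<close> of
    both mixed derivatives, yet the common second difference quotient provides one that
    does.\<close>
  define e where "e = \<bar>?E u v x - ?E v u x\<bar> / 2"
  assume "?E u v x \<noteq> ?E v u x"
  then have e: "e > 0" by (simp add: e_def)
  have f': "Ck_on (Suc (Suc 0)) S f" using f by (simp only: numeral_2_eq_2)
  have "continuous_on S (?E u v)" for u v using f' by simp
  then have "isCont (?E u v) x" for u v using S x by (simp add: continuous_on_eq_continuous_at)
  then have "\<exists>d>0. \<forall>y. dist y x < d \<longrightarrow> dist (?E u v y) (?E u v x) < e" for u v
    using e by (simp add: continuous_at_eps_delta)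
  then obtain d1 d2 where d1: "d1 > 0" "\<And>y. dist y x < d1 \<Longrightarrow> dist (?E u v y) (?E u v x) < e"
    and d2: "d2 > 0" "\<And>y. dist y x < d2 \<Longrightarrow> dist (?E v u y) (?E v u x) < e" by meson
  obtain d3 where d3: "d3 > 0" "ball x d3 \<subseteq> S" using S x open_contains_ball by blast
  define d where "d = min d1 (min d2 d3)"
  have d: "d > 0" using d1 d2 d3 by (simp add: d_def)
  \<comment> \<open>Keeps the whole parallelogram spanned by \<open>h u\<close> and
    \<open>h v\<close> within distance d of x; the summand 1 prevents division by zero when both
    vectors vanish.\<close>
  define h where "h = d / (2 * (norm u + norm v + 1))"
  have nn: "norm u + norm v + 1 > 0" by (simp add: add_nonneg_pos)
  have h: "h > 0" using d nn by (simp add: h_def)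
  have hd: "h * (norm u + norm v) < d"
  proof -
    have "h * (norm u + norm v) \<le> h * (norm u + norm v + 1)" using h by simp
    also have "\<dots> = d / 2" using nn unfolding h_def by (simp add: divide_simps del: distrib_left_numeral)
    finally show ?thesis using d by simp
  qed
  have near: "dist (x + s *\<^sub>R u + t *\<^sub>R v) x < d" if "0 \<le> s" "s \<le> h" "0 \<le> t" "t \<le> h" for s t
  proof -
    have "norm (s *\<^sub>R u + t *\<^sub>R v) \<le> s * norm u + t * norm v"
      using norm_triangle_ineq[of "s *\<^sub>R u" "t *\<^sub>R v"] that by simp
    also have "\<dots> \<le> h * norm u + h * norm v"
      using that by (intro add_mono mult_right_mono) auto
    also have "\<dots> < d" using hd by (simp add: algebra_simps)
    finally show ?thesis by (simp add: dist_norm add.assoc)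
  qed
  have near': "dist (x + s *\<^sub>R v + t *\<^sub>R u) x < d" if "0 \<le> s" "s \<le> h" "0 \<le> t" "t \<le> h" for s t
    using near[OF that(3,4,1,2)] by (simp add: algebra_simps)
  have inS: "y \<in> S" if "dist y x < d" for y using that d3 by (auto simp: d_def dist_commute)
  obtain s t where st: "0 \<le> s" "s \<le> h" "0 \<le> t" "t \<le> h"
    "f (x + h *\<^sub>R u + h *\<^sub>R v) - f (x + h *\<^sub>R u) - f (x + h *\<^sub>R v) + f x
      = h * h * ?E u v (x + s *\<^sub>R u + t *\<^sub>R v)"
    using second_difference_mean_value[OF f h, of x u v] inS near by metis
  obtain s' t' where st': "0 \<le> s'" "s' \<le> h" "0 \<le> t'" "t' \<le> h"
    "f (x + h *\<^sub>R v + h *\<^sub>R u) - f (x + h *\<^sub>R v) - f (x + h *\<^sub>R u) + f x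
      = h * h * ?E v u (x + s' *\<^sub>R v + t' *\<^sub>R u)"
    using second_difference_mean_value[OF f h, of x v u] inS near' by metis
  have "h * h * ?E u v (x + s *\<^sub>R u + t *\<^sub>R v) = h * h * ?E v u (x + s' *\<^sub>R v + t' *\<^sub>R u)"
    using st(5) st'(5) by (simp add: algebra_simps)
  then have eq: "?E u v (x + s *\<^sub>R u + t *\<^sub>R v) = ?E v u (x + s' *\<^sub>R v + t' *\<^sub>R u)" using h by simp
  have "dist (?E u v (x + s *\<^sub>R u + t *\<^sub>R v)) (?E u v x) < e"
    using near[OF st(1-4)] by (intro d1) (simp add: d_def)
  moreover have "dist (?E v u (x + s' *\<^sub>R v + t' *\<^sub>R u)) (?E v u x) < e"
    using near'[OF st'(1-4)] by (intro d2) (simp add: d_def)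
  moreover have "dist (?E u v x) (?E v u x) = 2 * e" by (simp add: e_def dist_real_def)
  ultimately show False
    using dist_triangle3[of "?E u v x" "?E v u x" "?E v u (x + s' *\<^sub>R v + t' *\<^sub>R u)"]
    unfolding eq by linarith
qed

lemma second_derivative_symmetric:
  fixes f :: "'a::euclidean_space \<Rightarrow> 'b::euclidean_space"
  assumes S: "open S" and f: "Ck_on 2 S f" and x: "x \<in> S"
  shows "frechet_derivative (\<lambda>y. frechet_derivative f (at y) u) (at x) v
    = frechet_derivative (\<lambda>y. frechet_derivative f (at y) v) (at x) u"
proof (rule euclidean_eqI)
  fix b :: 'b
  have f': "Ck_on (Suc (Suc 0)) S f" using f by (simp only: numeral_2_eq_2)
  note f1 = Ck_on_SucD[OF f']
  have D: "frechet_derivative (\<lambda>y. f y \<bullet> b) (at y) = (\<lambda>h. frechet_derivative f (at y) h \<bullet> b)" if "y \<in> S" for y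
    using has_derivative_inner_left[OF Ck_on_SucE[OF f1 that]] by (rule frechet_derivative_at[symmetric])
  have E: "frechet_derivative (\<lambda>y. frechet_derivative (\<lambda>y. f y \<bullet> b) (at y) u) (at x)
      = (\<lambda>h. frechet_derivative (\<lambda>y. frechet_derivative f (at y) u) (at x) h \<bullet> b)" for u
  proof -
    have "Ck_on (Suc 0) S (\<lambda>y. frechet_derivative f (at y) u)" using f' by (metis Ck_on.simps(2))
    from has_derivative_inner_left[OF Ck_on_SucE[OF this x]]
    have "((\<lambda>y. frechet_derivative (\<lambda>y. f y \<bullet> b) (at y) u) has_derivative
        (\<lambda>h. frechet_derivative (\<lambda>y. frechet_derivative f (at y) u) (at x) h \<bullet> b)) (at x)"
      by (rule has_derivative_transform_within_open[OF _ S x]) (simp add: D)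
    then show ?thesis by (rule frechet_derivative_at[symmetric])
  qed
  have "Ck_on 2 S (\<lambda>y. f y \<bullet> b)" by (rule Ck_on_linear_comp[OF S bounded_linear_inner_left f])
  from second_derivative_symmetric_real[OF S this x, of u v]
  show "frechet_derivative (\<lambda>y. frechet_derivative f (at y) u) (at x) v \<bullet> b
    = frechet_derivative (\<lambda>y. frechet_derivative f (at y) v) (at x) u \<bullet> b"
    by (simp add: E)
qed

section \<open>Bilinear forms that vary with the point\<close>

lemma bilinear_expansion:
  fixes B :: "'a::euclidean_space \<Rightarrow> 'a \<Rightarrow> real"
  assumes "bilinear B"
  shows "B u v = (\<Sum>i\<in>Basis. \<Sum>j\<in>Basis. ((u \<bullet> i) * (v \<bullet> j)) * B i j)"
proof -
  have "B u v = B (\<Sum>i\<in>Basis. (u \<bullet> i) *\<^sub>R i) (\<Sum>j\<in>Basis. (v \<bullet> j) *\<^sub>R j)"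
    by (simp add: euclidean_representation)
  also have "\<dots> = (\<Sum>i\<in>Basis. \<Sum>j\<in>Basis. B ((u \<bullet> i) *\<^sub>R i) ((v \<bullet> j) *\<^sub>R j))"
    by (subst bilinear_sum[OF assms]) (simp add: sum.cartesian_product)
  also have "\<dots> = (\<Sum>i\<in>Basis. \<Sum>j\<in>Basis. ((u \<bullet> i) * (v \<bullet> j)) * B i j)"
    by (simp add: bilinear_lmul[OF assms] bilinear_rmul[OF assms] mult.assoc mult.left_commute)
  finally show ?thesis .
qed

text \<open>The derivative of the form is known only for constant arguments. Expansion in the basis
  turns moving arguments into scalar coefficients, and the ordinary product rule applies.\<close>

lemma bilinear_field_deriv:
  fixes \<Omega> :: "'e::euclidean_space \<Rightarrow> 'e \<Rightarrow> 'e \<Rightarrow> real"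
    and F h k :: "'a::euclidean_space \<Rightarrow> 'e"
  assumes W: "open W" "s0 \<in> W" and V: "open V" "F ` W \<subseteq> V"
    and bil: "\<And>y. y \<in> V \<Longrightarrow> bilinear (\<lambda>u v. \<Omega> u v y)"
    and \<Omega>: "\<And>u v. (\<Omega> u v has_derivative \<Omega>' u v) (at (F s0))"
    and F: "(F has_derivative F') (at s0)"
    and h: "(h has_derivative h') (at s0)" and k: "(k has_derivative k') (at s0)"
  shows "((\<lambda>s. \<Omega> (h s) (k s) (F s)) has_derivative
    (\<lambda>l. \<Omega> (h' l) (k s0) (F s0) + \<Omega> (h s0) (k' l) (F s0) + \<Omega>' (h s0) (k s0) (F' l))) (at s0)"
proof -
  have y0: "F s0 \<in> V" using W V by auto
  note bx = bilinear_expansion[OF bil]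
  have "((\<lambda>y. \<Sum>i\<in>Basis. \<Sum>j\<in>Basis. ((u \<bullet> i) * (v \<bullet> j)) * \<Omega> i j y) has_derivative
      (\<lambda>l. \<Sum>i\<in>Basis. \<Sum>j\<in>Basis. ((u \<bullet> i) * (v \<bullet> j)) * \<Omega>' i j l)) (at (F s0))" for u v
    by (intro has_derivative_sum has_derivative_mult_right \<Omega>)
  then have "(\<Omega> u v has_derivative
      (\<lambda>l. \<Sum>i\<in>Basis. \<Sum>j\<in>Basis. ((u \<bullet> i) * (v \<bullet> j)) * \<Omega>' i j l)) (at (F s0))" for u v
    by (rule has_derivative_transform_within_open[OF _ V(1) y0]) (simp add: bx[symmetric])
  \<comment> \<open>The derivative inherits the basis expansion of \<Omega> because derivatives are
    unique; this allows the final sum to be folded back.\<close>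
  from has_derivative_unique[OF \<Omega> this]
  have \<Omega>'x: "\<Omega>' u v l = (\<Sum>i\<in>Basis. \<Sum>j\<in>Basis. ((u \<bullet> i) * (v \<bullet> j)) * \<Omega>' i j l)" for u v l
    by (rule fun_cong)
  have "((\<lambda>s. \<Sum>i\<in>Basis. \<Sum>j\<in>Basis. ((h s \<bullet> i) * (k s \<bullet> j)) * \<Omega> i j (F s)) has_derivative
      (\<lambda>l. \<Sum>i\<in>Basis. \<Sum>j\<in>Basis. ((h s0 \<bullet> i) * (k s0 \<bullet> j)) * \<Omega>' i j (F' l)
        + ((h s0 \<bullet> i) * (k' l \<bullet> j) + (h' l \<bullet> i) * (k s0 \<bullet> j)) * \<Omega> i j (F s0))) (at s0)"
    by (intro has_derivative_sum has_derivative_mult has_derivative_inner_left h k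
        has_derivative_compose[OF F \<Omega>])
  then have "((\<lambda>s. \<Omega> (h s) (k s) (F s)) has_derivative
      (\<lambda>l. \<Sum>i\<in>Basis. \<Sum>j\<in>Basis. ((h s0 \<bullet> i) * (k s0 \<bullet> j)) * \<Omega>' i j (F' l)
        + ((h s0 \<bullet> i) * (k' l \<bullet> j) + (h' l \<bullet> i) * (k s0 \<bullet> j)) * \<Omega> i j (F s0))) (at s0)"
    by (rule has_derivative_transform_within_open[OF _ W]) (use V bx in \<open>auto simp: image_subset_iff\<close>)
  then show ?thesis
    by (rule has_derivative_eq_rhs)
      (simp only: fun_eq_iff bx[OF y0, of "h' _" "k s0"] bx[OF y0, of "h s0" "k' _"] \<Omega>'x[of "h s0" "k s0"]
        sum.distrib[symmetric] distrib_left distrib_right ac_simps simp_thms)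
qed

text \<open>The second derivatives of \<open>F\<close> cancel in the cyclic sum because they are symmetric.\<close>
lemma pullback_exterior_deriv:
  fixes \<Omega> :: "'e::euclidean_space \<Rightarrow> 'e \<Rightarrow> 'e \<Rightarrow> real" and F :: "'a::euclidean_space \<Rightarrow> 'e"
  assumes W: "open W" "s0 \<in> W" and V: "open V" "F ` W \<subseteq> V" and F: "Ck_on 2 W F"
    and bil: "\<And>y. y \<in> V \<Longrightarrow> bilinear (\<lambda>u v. \<Omega> u v y)"
    and anti: "\<And>u v. \<Omega> v u (F s0) = - \<Omega> u v (F s0)"
    and \<Omega>: "\<And>u v. (\<Omega> u v has_derivative \<Omega>' u v) (at (F s0))"
  defines "\<Psi> \<equiv> \<lambda>h k s. \<Omega> (frechet_derivative F (at s) h) (frechet_derivative F (at s) k) (F s)"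
    and "d \<equiv> frechet_derivative F (at s0)"
  shows "\<Psi> h k differentiable (at s0)"
    and "frechet_derivative (\<Psi> k l) (at s0) h + frechet_derivative (\<Psi> l h) (at s0) k
        + frechet_derivative (\<Psi> h k) (at s0) l
      = \<Omega>' (d k) (d l) (d h) + \<Omega>' (d l) (d h) (d k) + \<Omega>' (d h) (d k) (d l)"
proof -
  have F': "Ck_on (Suc (Suc 0)) W F" using F by (simp only: numeral_2_eq_2)
  have F1: "(F has_derivative d) (at s0)" unfolding d_def by (rule Ck_on_SucE[OF Ck_on_SucD[OF F'] W(2)])
  define E where "E = (\<lambda>h. frechet_derivative (\<lambda>s. frechet_derivative F (at s) h) (at s0))"
  have F2: "((\<lambda>s. frechet_derivative F (at s) h) has_derivative E h) (at s0)" for h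
  proof -
    have "Ck_on (Suc 0) W (\<lambda>s. frechet_derivative F (at s) h)" using F' by (metis Ck_on.simps(2))
    from Ck_on_SucE[OF this W(2)] show ?thesis by (simp add: E_def)
  qed
  have E: "E h k = E k h" for h k
    unfolding E_def by (rule second_derivative_symmetric[OF W(1) F W(2)])
  have \<Psi>: "(\<Psi> h k has_derivative (\<lambda>l. \<Omega> (E h l) (d k) (F s0) + \<Omega> (d h) (E k l) (F s0)
      + \<Omega>' (d h) (d k) (d l))) (at s0)" for h k
    unfolding \<Psi>_def d_def
    by (rule bilinear_field_deriv[OF W V bil \<Omega> _ F2 F2]) (use F1 d_def in auto)
  then show "\<Psi> h k differentiable (at s0)" by (auto simp: differentiable_def)
  have \<Psi>': "frechet_derivative (\<Psi> h k) (at s0) l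
      = \<Omega> (E h l) (d k) (F s0) + \<Omega> (d h) (E k l) (F s0) + \<Omega>' (d h) (d k) (d l)" for h k l
    by (rule fun_cong[OF frechet_derivative_at[OF \<Psi>[of h k]], symmetric])
  show "frechet_derivative (\<Psi> k l) (at s0) h + frechet_derivative (\<Psi> l h) (at s0) k
        + frechet_derivative (\<Psi> h k) (at s0) l
      = \<Omega>' (d k) (d l) (d h) + \<Omega>' (d l) (d h) (d k) + \<Omega>' (d h) (d k) (d l)"
    \<comment> \<open>Each second derivative occurs twice, once in either slot of \<Omega>, so
      antisymmetry is needed together with symmetry of \<open>E\<close>.\<close>
    unfolding \<Psi>' using anti[of "E k h" "d l"] anti[of "E l h" "d k"] anti[of "E l k" "d h"]
    by (simp add: E)
qed

section \<open>Slant fibres of a warped product\<close>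

lemma metric_nonneg:
  assumes "smooth_atlas A" "riemannian_metric A g" "v \<in> tangent_space A p"
  shows "g p v v \<ge> 0"
proof (cases "v = 0")
  case True
  then show ?thesis using metric_lincomb_right[OF assms(2,3,3,3), of 0 0] by simp
next
  case False
  then show ?thesis using assms unfolding riemannian_metric_def by (meson less_imp_le)
qed

lemma metric_zero_right:
  assumes "riemannian_metric A g" "v \<in> tangent_space A p"
  shows "g p v 0 = 0"
  using metric_lincomb_right[OF assms assms(2,2), of 0 0] by simp

text \<open>Needed to keep the cosine quotient in [-1, 1], where \<open>arccos\<close> is monotone
  and inverted by \<open>cos\<close>.\<close>

lemma metric_cauchy_schwarz:
  assumes A: "smooth_atlas A" and g: "riemannian_metric A g"
    and v: "v \<in> tangent_space A p" and w: "w \<in> tangent_space A p"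
  shows "\<bar>g p v w\<bar> \<le> sqrt (g p v v) * sqrt (g p w w)"
proof (cases "w = 0")
  case True
  then show ?thesis using metric_zero_right[OF g v] metric_zero_right[OF g w] by simp
next
  case False
  then have pos: "g p w w > 0" using g w unfolding riemannian_metric_def by blast
  define t where "t = g p v w / g p w w"
  let ?x = "1 *\<^sub>R v + (- t) *\<^sub>R w"
  have x: "?x \<in> tangent_space A p" by (rule tangent_space_lincomb[OF A v w])
  have "g p ?x ?x = g p v v - 2 * t * g p v w + t * t * g p w w"
    unfolding metric_lincomb_right[OF g x v w] metric_lincomb_left[OF A g v v w]
      metric_lincomb_left[OF A g w v w] metric_sym[OF g w v]
    by (simp add: algebra_simps)
  also have "\<dots> = g p v v - (g p v w)\<^sup>2 / g p w w"
    using pos by (simp add: t_def field_simps power2_eq_square)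
  finally have "(g p v w)\<^sup>2 / g p w w \<le> g p v v" using metric_nonneg[OF A g x] by simp
  then have "(g p v w)\<^sup>2 \<le> g p v v * g p w w" using pos by (simp add: field_simps)
  then show ?thesis by (metis real_sqrt_abs real_sqrt_le_iff real_sqrt_mult)
qed

text \<open>The quotient is unchanged under positive scaling, so its supremum is a maximum over the
  compact unit sphere.\<close>

lemma linear_over_norm_attains_max:
  fixes L :: "'d::euclidean_space \<Rightarrow> real"
  assumes L: "linear L" and B: "bilinear B" and pos: "\<And>u. u \<noteq> 0 \<Longrightarrow> B u u > 0"
  obtains u0 where "u0 \<noteq> 0" "\<And>u. u \<noteq> 0 \<Longrightarrow> L u / sqrt (B u u) \<le> L u0 / sqrt (B u0 u0)"
proof -
  let ?r = "\<lambda>u. L u / sqrt (B u u)"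
  have Bc: "continuous_on S (\<lambda>u. B u u)" for S
    using bounded_bilinear.continuous_on[OF bilinear_conv_bounded_bilinear[THEN iffD1, OF B]
        continuous_on_id continuous_on_id] .
  have Lc: "continuous_on S L" for S using L linear_continuous_on linear_conv_bounded_linear by blast
  have rc: "continuous_on (sphere 0 1) ?r"
    by (intro continuous_on_divide Lc continuous_on_real_sqrt Bc ballI)
      (use pos in \<open>metis mem_sphere_0 norm_zero real_sqrt_eq_zero_cancel_iff less_irrefl zero_neq_one\<close>)
  then obtain u0 where u0: "u0 \<in> sphere 0 1" "\<And>u. u \<in> sphere 0 1 \<Longrightarrow> ?r u \<le> ?r u0"
    using continuous_attains_sup[OF compact_sphere[of "0::'d" 1] _ rc] by (metis sphere_eq_empty not_one_less_zero)
  have "?r u \<le> ?r u0" if "u \<noteq> 0" for u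
  proof -
    define v where "v = (1 / norm u) *\<^sub>R u"
    have u: "u = norm u *\<^sub>R v" and v: "v \<in> sphere 0 1" "v \<noteq> 0" using that by (auto simp: v_def)
    have "?r u = (norm u * L v) / sqrt (norm u * (norm u * B v v))"
      by (subst (1 2 3) u)
        (simp only: linear_scale[OF L] bilinear_lmul[OF B] bilinear_rmul[OF B] real_scaleR_def)
    also have "\<dots> = ?r v"
      using that by (simp add: real_sqrt_mult mult.assoc[symmetric])
    finally show ?thesis using u0(2)[OF v(1)] by simp
  qed
  moreover have "u0 \<noteq> 0" using u0(1) by auto
  ultimately show ?thesis using that by blast
qed

text \<open>As \<open>arccos\<close> is decreasing, the least angle belongs to the largest cosine.
  That maximum exists by compactness, so the infimum is attained and can be traded for an inequality
  with a case of equality.\<close>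

lemma angle_to_subspace_attained:
  fixes A :: "('m::topological_space, 'e::euclidean_space) chart set"
    and L :: "'d::euclidean_space \<Rightarrow> ('m, 'e) tangent"
  assumes A: "smooth_atlas A" and g: "riemannian_metric A g"
    and v: "v \<in> tangent_space A p" "v \<noteq> 0"
    and L: "\<And>u. L u \<in> tangent_space A p" "\<forall>u. u \<noteq> 0 \<longrightarrow> L u \<noteq> 0"
    and lin: "\<And>r s u w. L (r *\<^sub>R u + s *\<^sub>R w) = r *\<^sub>R L u + s *\<^sub>R L w"
    and \<theta>: "angle_to_subspace g p v (range L) = \<theta>"
  shows "u \<noteq> 0 \<Longrightarrow> g p v (L u) \<le> cos \<theta> * (sqrt (g p v v) * sqrt (g p (L u) (L u)))"
    and "\<exists>u\<noteq>0. g p v (L u) = cos \<theta> * (sqrt (g p v v) * sqrt (g p (L u) (L u)))"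
    and "0 \<le> \<theta>" "\<theta> \<le> pi"
proof -
  have pos: "g p w w > 0" if "w \<in> tangent_space A p" "w \<noteq> 0" for w
    using g that unfolding riemannian_metric_def by blast
  define B where "B = (\<lambda>u w. g p (L u) (L w))"
  have gvv: "sqrt (g p v v) > 0" using pos[OF v] by simp
  have BL: "sqrt (B u u) > 0" if "u \<noteq> 0" for u using pos[OF L(1) L(2)[rule_format, OF that]] by (simp add: B_def)
  have add: "L (u + w) = 1 *\<^sub>R L u + 1 *\<^sub>R L w" for u w using lin[of 1 u 1 w] by simp
  have scale: "L (r *\<^sub>R u) = r *\<^sub>R L u + 0 *\<^sub>R L u" for r u using lin[of r u 0 u] by simp
  have l1: "linear (\<lambda>u. g p w (L u))" if "w \<in> tangent_space A p" for w
    by (rule linearI; simp only: add scale metric_lincomb_right[OF g that L(1) L(1)]) simp_all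
  have l2: "linear (\<lambda>u. g p (L u) w)" if "w \<in> tangent_space A p" for w
    by (rule linearI; simp only: add scale metric_lincomb_left[OF A g that L(1) L(1)]) simp_all
  have bil: "bilinear B" unfolding B_def bilinear_def using l1[OF L(1)] l2[OF L(1)] by blast
  obtain u0 where u0: "u0 \<noteq> 0"
    "\<And>u. u \<noteq> 0 \<Longrightarrow> g p v (L u) / sqrt (B u u) \<le> g p v (L u0) / sqrt (B u0 u0)"
    using linear_over_norm_attains_max[OF l1[OF v(1)] bil] pos[OF L(1) L(2)[rule_format]] by (auto simp: B_def)
  define r where "r = (\<lambda>u. g p v (L u) / (sqrt (g p v v) * sqrt (B u u)))"
  have rle: "r u \<le> r u0" if "u \<noteq> 0" for u
    using divide_right_mono[OF u0(2)[OF that], of "sqrt (g p v v)"] gvv by (simp add: r_def mult.commute)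
  have r1: "- 1 \<le> r u" "r u \<le> 1" if "u \<noteq> 0" for u
  proof -
    have "\<bar>r u\<bar> \<le> 1"
      using metric_cauchy_schwarz[OF A g v(1) L(1)[of u]] gvv BL[OF that] by (simp add: r_def B_def abs_mult)
    then show "- 1 \<le> r u" "r u \<le> 1" by auto
  qed
  have va: "vec_angle g p v (L u) = arccos (r u)" for u by (simp add: vec_angle_def r_def B_def)
  have "L 0 = 0" using lin[of 0 0 0 0] by simp
  then have ne: "range L - {0} = L ` (- {0})" using L(2) by (auto intro!: imageI)
  have "\<theta> = arccos (r u0)"
    unfolding \<theta>[symmetric] angle_to_subspace_def
  proof (rule cInf_eq_minimum)
    show "arccos (r u0) \<in> vec_angle g p v ` (range L - {0})"
      unfolding ne va[symmetric] using u0(1) by blast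
    fix \<alpha> assume "\<alpha> \<in> vec_angle g p v ` (range L - {0})"
    then obtain u where "u \<noteq> 0" "\<alpha> = arccos (r u)" unfolding ne image_image va by blast
    then show "arccos (r u0) \<le> \<alpha>" using rle r1 u0(1) by (auto intro: arccos_le_arccos)
  qed
  then have c: "cos \<theta> = r u0" and "0 \<le> \<theta>" "\<theta> \<le> pi"
    using r1[OF u0(1)] by (simp_all add: arccos_lbound arccos_ubound cos_arccos)
  then show "0 \<le> \<theta>" "\<theta> \<le> pi" by blast+
  have rg: "g p v (L u) = r u * (sqrt (g p v v) * sqrt (g p (L u) (L u)))" if "u \<noteq> 0" for u
    using gvv BL[OF that] by (simp add: r_def B_def)
  show "g p v (L u) \<le> cos \<theta> * (sqrt (g p v v) * sqrt (g p (L u) (L u)))" if "u \<noteq> 0"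
    unfolding c using rg[OF that] rle[OF that] gvv BL[OF that]
    by (simp add: B_def mult_right_mono)
  show "\<exists>u\<noteq>0. g p v (L u) = cos \<theta> * (sqrt (g p v v) * sqrt (g p (L u) (L u)))"
    unfolding c using rg[OF u0(1)] u0(1) by blast
qed

text \<open>The slant condition is applied to \<open>\<phi> (L u)\<close>, whose length is
  \<open>f p\<close> times the length of \<open>u\<close> in \<open>g2\<close>. The norms
  \<open>N\<close> do not involve \<open>p\<close>: along the first factor only the warping function
  changes the bound.\<close>

lemma warped_product_slant_fibre:
  fixes B1 :: "('a::topological_space, 'b::euclidean_space) chart set"
    and B2 :: "('c::topological_space, 'd::euclidean_space) chart set"
    and A :: "('m::topological_space, 'e::euclidean_space) chart set"
  assumes A: "smooth_atlas A" and acm: "almost_contact_metric A \<phi> \<xi> \<eta> g"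
    and wp: "warped_product_submanifold B1 g1 B2 g2 f A g j"
    and \<xi>: "\<xi> (j (p, q)) \<in> differential (product_atlas B1 B2) A j (p, q) ` first_factor_bundle B1 B2 (p, q)"
    and slant: "proper_slant_submanifold B2 A \<phi> \<xi> g (\<lambda>q. j (p, q)) \<theta>"
    and c2: "c2 \<in> B2" "q \<in> fst c2" and u: "u \<noteq> 0"
  defines "L \<equiv> \<lambda>u. differential B2 A (\<lambda>q. j (p, q)) q (tangent_of_coords B2 c2 q u)"
    and "N \<equiv> \<lambda>u. g2 q (tangent_of_coords B2 c2 q u) (tangent_of_coords B2 c2 q u)"
  shows "w \<noteq> 0 \<Longrightarrow> g (j (p, q)) (\<phi> (j (p, q)) (L u)) (L w) \<le> cos \<theta> * (sqrt (N u) * sqrt (N w)) * (f p)\<^sup>2"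
    and "\<exists>w\<noteq>0. g (j (p, q)) (\<phi> (j (p, q)) (L u)) (L w) = cos \<theta> * (sqrt (N u) * sqrt (N w)) * (f p)\<^sup>2"
    and "N u > 0" and "cos \<theta> \<noteq> 0"
proof -
  let ?P = "product_atlas B1 B2" and ?x = "(p, q)" and ?t = "tangent_of_coords B2 c2 q"
  let ?\<iota> = "differential B2 ?P (\<lambda>q. (p, q)) q" and ?dj = "differential ?P A j (p, q)"
  note acmD = almost_contact_metricD[OF acm]
  have B1: "smooth_atlas B1" and B2: "smooth_atlas B2" and g1: "riemannian_metric B1 g1"
    and g2: "riemannian_metric B2 g2" and fpos: "f p > 0" and imm: "immersion ?P A j"
    and met: "\<And>v w. v \<in> tangent_space ?P ?x \<Longrightarrow> w \<in> tangent_space ?P ?x \<Longrightarrow>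
      g (j ?x) (?dj v) (?dj w) = warped_metric B1 g1 B2 g2 f ?x v w"
    using wp unfolding warped_product_submanifold_def Let_def by blast+
  have P: "smooth_atlas ?P" by (rule smooth_atlas_product[OF B1 B2])
  have j: "diff_map ?P A j" using imm by (auto simp: immersion_def intro: smooth_map_imp_diff_map)
  note ml = diff_map_left_slice[OF B1 B2, of q] and mr = diff_map_right_slice[OF B1 B2, of p]
  have immp: "immersion B2 A (\<lambda>q. j (p, q))"
    and sl: "\<And>X. X \<in> tangent_image B2 A (\<lambda>q. j (p, q)) q \<Longrightarrow> X \<noteq> 0 \<Longrightarrow> (\<nexists>a. X = a *\<^sub>R \<xi> (j ?x)) \<Longrightarrow>
      angle_to_subspace g (j ?x) (\<phi> (j ?x) X) (tangent_image B2 A (\<lambda>q. j (p, q)) q) = \<theta>"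
    and \<theta>: "\<theta> \<noteq> pi / 2"
    using slant unfolding proper_slant_submanifold_def slant_submanifold_def by blast+
  have jp: "diff_map B2 A (\<lambda>q. j (p, q))"
    using immp by (auto simp: immersion_def intro: smooth_map_imp_diff_map)
  have tin: "?t u \<in> tangent_space B2 q" for u by (rule tangent_of_coords_in[OF B2 c2])
  have tc: "?t u c2 = u" for u using B2 c2 by simp
  have L: "L u = ?dj (?\<iota> (?t u))" for u
    using differential_comp[OF B2 P mr j tin] by (simp add: L_def comp_def)
  have Lin: "L u \<in> tangent_space A (j ?x)" for u
    unfolding L_def by (rule differential_in[OF B2 A jp tin])
  have Llin: "L (r *\<^sub>R u + s *\<^sub>R w) = r *\<^sub>R L u + s *\<^sub>R L w" for r s u w
    unfolding L_def tangent_of_coords_lincomb[OF B2 c2] by (rule differential_lincomb[OF B2 jp tin tin])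
  have rangeL: "range L = tangent_image B2 A (\<lambda>q. j (p, q)) q"
  proof -
    have "range ?t = tangent_space B2 q"
      using tin tangent_of_coords_eq[OF B2 c2] by (metis image_subset_iff rangeI subsetI subset_antisym)
    then show ?thesis unfolding tangent_image_def L_def by (metis image_image)
  qed
  have \<iota>in: "?\<iota> (?t u) \<in> tangent_space ?P ?x" for u by (rule differential_in[OF B2 P mr tin])
  have \<iota>1: "differential ?P B1 fst ?x (?\<iota> (?t u)) = 0" for u
    using differential_comp[OF B2 P mr diff_map_fst[OF B1 B2] tin]
    by (simp add: comp_def differential_const)
  have \<iota>2: "differential ?P B2 snd ?x (?\<iota> (?t u)) = ?t u" for u
    using differential_comp[OF B2 P mr diff_map_snd[OF B1 B2] tin] differential_id[OF B2 tin]
    by (simp add: comp_def id_def)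
  have g10: "g1 p 0 0 = 0" by (rule metric_zero_right[OF g1 tangent_space_zero[OF B1]])
  have gL: "g (j ?x) (L u) (L w) = (f p)\<^sup>2 * g2 q (?t u) (?t w)" for u w
    unfolding L met[OF \<iota>in \<iota>in] by (simp add: warped_metric_def Let_def \<iota>1 \<iota>2 g10)
  have Npos: "N u > 0" if "u \<noteq> 0" for u
  proof -
    have "?t u \<noteq> 0" using tc[of u] that by auto
    then show ?thesis using g2 tin unfolding N_def riemannian_metric_def by blast
  qed
  then show "N u > 0" using u by blast
  \<comment> \<open>The two factors are orthogonal in the warped metric. Hence \<eta> vanishes on
    \<open>L u\<close>, and a nonzero \<open>L u\<close> is not a multiple of \<xi>, so that the
    slant condition may be applied to it.\<close>
  have g\<xi>: "g (j ?x) (L u) (\<xi> (j ?x)) = 0" for u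
  proof -
    obtain z where z: "z \<in> tangent_space B1 p" "\<xi> (j ?x) = ?dj (differential B1 ?P (\<lambda>p. (p, q)) p z)"
      using \<xi> by (auto simp: first_factor_bundle_def tangent_image_def)
    let ?z = "differential B1 ?P (\<lambda>p. (p, q)) p z"
    have zin: "?z \<in> tangent_space ?P ?x" by (rule differential_in[OF B1 P ml z(1)])
    have z1: "differential ?P B1 fst ?x ?z \<in> tangent_space B1 p"
      using differential_in[OF P B1 diff_map_fst[OF B1 B2] zin] by simp
    have z2: "differential ?P B2 snd ?x ?z = 0"
      using differential_comp[OF B1 P ml diff_map_snd[OF B1 B2] z(1)]
      by (simp add: comp_def differential_const)
    have "g1 p 0 (differential ?P B1 fst ?x ?z) = 0"
      using metric_sym[OF g1 z1 tangent_space_zero[OF B1]] metric_zero_right[OF g1 z1] by simp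
    then show ?thesis
      unfolding L z(2) met[OF \<iota>in zin]
      by (simp add: warped_metric_def Let_def \<iota>1 \<iota>2 z2 metric_zero_right[OF g2 tin])
  qed
  have pos: "g (j ?x) (L u) (L u) > 0" if "u \<noteq> 0" for u
    using gL[of u u] Npos[OF that] fpos by (simp add: N_def)
  have L0: "L u \<noteq> 0" if "u \<noteq> 0" for u
    using pos[OF that] metric_zero_right[OF acmD(1) Lin[of u]] by force
  then have L0': "\<forall>u. u \<noteq> 0 \<longrightarrow> L u \<noteq> 0" by blast
  have npar: "\<nexists>a. L u = a *\<^sub>R \<xi> (j ?x)"
  proof
    assume "\<exists>a. L u = a *\<^sub>R \<xi> (j ?x)"
    then obtain a where a: "L u = a *\<^sub>R \<xi> (j ?x) + 0 *\<^sub>R \<xi> (j ?x)" by auto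
    have "g (j ?x) (L u) (L u) = a * g (j ?x) (L u) (\<xi> (j ?x))"
      by (subst (2) a, subst metric_lincomb_right[OF acmD(1) Lin acmD(5) acmD(5)]) simp
    then show False using g\<xi>[of u] pos[OF u] by simp
  qed
  have \<phi>L: "g (j ?x) (\<phi> (j ?x) (L u)) (\<phi> (j ?x) (L u)) = (f p)\<^sup>2 * N u"
    using acmD(8)[OF Lin Lin, of u u] acmD(6)[OF Lin, of u] g\<xi>[of u] gL[of u u] by (simp add: N_def)
  have \<phi>0: "\<phi> (j ?x) (L u) \<noteq> 0"
    using \<phi>L Npos[OF u] fpos metric_zero_right[OF acmD(1) tangent_space_zero[OF A], of "j ?x"] by force
  note ang = angle_to_subspace_attained[where L = L, OF A acmD(1) acmD(3)[OF Lin] \<phi>0 Lin _ Llin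
      sl[folded rangeL, OF rangeI L0[OF u] npar], OF L0']
  have sq: "sqrt ((f p)\<^sup>2 * N u) * sqrt (g (j ?x) (L w) (L w)) = (sqrt (N u) * sqrt (N w)) * (f p)\<^sup>2" for w
    unfolding gL using fpos by (simp add: N_def real_sqrt_mult power2_eq_square)
  show "g (j (p, q)) (\<phi> (j (p, q)) (L u)) (L w) \<le> cos \<theta> * (sqrt (N u) * sqrt (N w)) * (f p)\<^sup>2"
    if "w \<noteq> 0" using ang(1)[OF that] unfolding \<phi>L sq by (simp add: mult.assoc)
  show "\<exists>w\<noteq>0. g (j (p, q)) (\<phi> (j (p, q)) (L u)) (L w) = cos \<theta> * (sqrt (N u) * sqrt (N w)) * (f p)\<^sup>2"
    using ang(2) unfolding \<phi>L sq by (simp add: mult.assoc)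
  \<comment> \<open>As an infimum that is attained by a value of \<open>arccos\<close>, \<theta>
    lies in [0, pi]; there \<open>cos\<close> is injective and vanishes only at the excluded value
    pi/2.\<close>
  show "cos \<theta> \<noteq> 0"
  proof
    assume "cos \<theta> = 0"
    then have "cos \<theta> = cos (pi / 2)" by simp
    then have "\<theta> = pi / 2" using cos_inj_pi[OF ang(3,4), of "pi / 2"] by simp
    then show False using \<theta> by blast
  qed
qed

section \<open>The warping function\<close>

theorem theorem4p2:
  fixes n :: nat
    and A :: "('m::{t2_space, second_countable_topology}, 'e::euclidean_space) chart set"
    and \<phi> :: "'m \<Rightarrow> ('m, 'e) tangent \<Rightarrow> ('m, 'e) tangent"
    and \<xi> :: "('m, 'e) vfield"
    and \<eta> :: "'m \<Rightarrow> ('m, 'e) tangent \<Rightarrow> real"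
    and g :: "('m, 'e) metric"
    and D :: "('m, 'e) vfield \<Rightarrow> ('m, 'e) vfield \<Rightarrow> ('m, 'e) vfield"
    and B1 :: "('a::{t2_space, second_countable_topology}, 'b::euclidean_space) chart set"
    and g1 :: "('a, 'b) metric"
    and B2 :: "('c::{t2_space, second_countable_topology}, 'd::euclidean_space) chart set"
    and g2 :: "('c, 'd) metric"
    and f :: "'a \<Rightarrow> real"
    and j :: "'a \<times> 'c \<Rightarrow> 'm"
    and \<theta> :: real
  assumes "smooth_atlas A" and "DIM('e) = 2 * n + 1"
    and "kenmotsu A \<phi> \<xi> \<eta> g D"
    and "warped_product_submanifold B1 g1 B2 g2 f A g j"
    and "\<And>x. \<xi> (j x) \<in> differential (product_atlas B1 B2) A j x ` first_factor_bundle B1 B2 x"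
    and "\<And>q. anti_invariant_submanifold B1 A \<phi> g (\<lambda>p. j (p, q))"
    and "\<And>p. proper_slant_submanifold B2 A \<phi> \<xi> g (\<lambda>q. j (p, q)) \<theta>"
    and "\<And>x. \<phi> (j x) ` differential (product_atlas B1 B2) A j x ` first_factor_bundle B1 B2 x
               \<subseteq> normal_tangent_space (product_atlas B1 B2) A g j x"
  shows "\<forall>x. \<forall>Z\<in>first_factor_bundle B1 B2 x.
           \<eta> (j x) (differential (product_atlas B1 B2) A j x Z)
             = dir_deriv (product_atlas B1 B2) x Z (\<lambda>y. ln (f (fst y)))"
proof (intro allI ballI)
  fix x :: "'a \<times> 'c" and Z
  assume Z: "Z \<in> first_factor_bundle B1 B2 x"
  let ?P = "product_atlas B1 B2"
  obtain p q where x: "x = (p, q)" by (cases x)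
  note A = assms(1) and wp = assms(4)
  have acm: "almost_contact_metric A \<phi> \<xi> \<eta> g" using assms(3) by (simp add: kenmotsu_def)
  have B1: "smooth_atlas B1" and B2: "smooth_atlas B2" and fsm: "smooth_fun B1 f"
    and fpos: "\<And>p. f p > 0" and imm: "immersion ?P A j"
    using wp unfolding warped_product_submanifold_def Let_def by blast+
  have P: "smooth_atlas ?P" by (rule smooth_atlas_product[OF B1 B2])
  have jsm: "smooth_map ?P A j" using imm by (simp add: immersion_def)
  then have j: "diff_map ?P A j" by (rule smooth_map_imp_diff_map)
  define a where "a = chart_at A (j x)"
  have a: "a \<in> A" "j x \<in> fst a" using chart_at[OF A] by (auto simp: a_def)
  define c where "c = chart_at ?P x"
  have c: "c \<in> ?P" "x \<in> fst c" using chart_at[OF P] by (auto simp: c_def)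
  obtain c1 c2 where c12: "c1 \<in> B1" "c2 \<in> B2" "c = (fst c1 \<times> fst c2, map_prod (snd c1) (snd c2))"
    using c(1) by (rule product_atlasE)
  have pq: "p \<in> fst c1" "q \<in> fst c2" using c(2) c12(3) x by auto
  let ?t = "tangent_of_coords ?P c" and ?t1 = "tangent_of_coords B1 c1" and ?t2 = "tangent_of_coords B2 c2"
  let ?dj = "differential ?P A j"
  define s0 where "s0 = snd c x"
  have s0: "s0 = (snd c1 p, snd c2 q)" by (simp add: s0_def c12(3) x)
  define F where "F = snd a \<circ> j \<circ> chart_inv c"
  define W where "W = snd c ` (fst c \<inter> j -` fst a)"
  define V where "V = snd a ` fst a"
  have "open (j -` fst a)"
    using jsm atlas_chart(1)[OF A a(1)] by (simp add: smooth_map_def continuous_on_open_vimage)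
  then have W: "open W" unfolding W_def by (rule chart_image_open[OF P c(1)])
  have s0W: "s0 \<in> W" using c a by (auto simp: W_def s0_def)
  have V: "open V" unfolding V_def by (rule atlas_chart(2)[OF A a(1)])
  have FW: "F ` W \<subseteq> V" using P c(1) by (auto simp: F_def W_def V_def)
  have "smooth_on W F" using jsm a(1) c(1) unfolding smooth_map_def W_def F_def by blast
  then have F2: "Ck_on 2 W F" by (simp only: smooth_on_def)
  define \<Omega> where "\<Omega> = coord_form A \<phi> g a"
  \<comment> \<open>The pullback of the fundamental form by \<open>j\<close>, in the product chart
    and on constant coordinate vectors.\<close>
  define \<Psi> where "\<Psi> = (\<lambda>h k s. \<Omega> (frechet_derivative F (at s) h) (frechet_derivative F (at s) k) (F s))"
  have dj: "?dj y (?t y h) = tangent_of_coords A a (j y) (frechet_derivative F (at (snd c y)) h)"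
    if y: "y \<in> fst c" "j y \<in> fst a" for y h
  proof (rule tangent_eqI[OF differential_in[OF P A j tangent_of_coords_in[OF P c(1) y(1)]]
        tangent_of_coords_in[OF A a(1) y(2)] a(1) y(2)])
    show "?dj y (?t y h) a
        = tangent_of_coords A a (j y) (frechet_derivative F (at (snd c y)) h) a"
      using differential_chart[OF P j tangent_of_coords_in[OF P c(1) y(1)] c(1) y(1) a(1) y(2)] A P a c y
      by (simp add: F_def)
  qed
  have \<Psi>: "\<Psi> h k (snd c y) = g (j y) (\<phi> (j y) (?dj y (?t y h))) (?dj y (?t y k))"
    if y: "y \<in> fst c" "j y \<in> fst a" for y h k
    using y A P a c by (simp add: \<Psi>_def \<Omega>_def coord_form_def dj F_def)
  have F0: "F s0 = snd a (j x)" using P c by (simp add: F_def s0_def)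
  have anti: "\<Omega> v u y = - \<Omega> u v y" if "y \<in> V" for u v y
    unfolding \<Omega>_def by (rule coord_form_antisym[OF A acm a(1)]) (use that in \<open>simp add: V_def\<close>)
  have bil: "bilinear (\<lambda>u v. \<Omega> u v y)" if "y \<in> V" for y
    unfolding \<Omega>_def using that coord_form_bilinear[OF A acm a(1)] by (simp add: V_def)
  have \<Omega>d: "(\<Omega> u v has_derivative frechet_derivative (\<Omega> u v) (at (F s0))) (at (F s0))" for u v
    using coord_form_differentiable[OF A assms(3), of "j x" u v]
    by (simp add: \<Omega>_def a_def F0 frechet_derivative_works)
  have F0V: "F s0 \<in> V" using FW s0W by blast
  let ?d = "frechet_derivative F (at s0)"
  note pb = pullback_exterior_deriv[OF W s0W V FW F2 bil anti[OF F0V] \<Omega>d]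
  have \<Psi>diff: "\<Psi> h k differentiable (at s0)" for h k
    unfolding \<Psi>_def by (rule pb(1))
  have \<Psi>cyc: "frechet_derivative (\<Psi> k l) (at s0) h + frechet_derivative (\<Psi> l h) (at s0) k
      + frechet_derivative (\<Psi> h k) (at s0) l
    = frechet_derivative (\<Omega> (?d k) (?d l)) (at (F s0)) (?d h)
      + frechet_derivative (\<Omega> (?d l) (?d h)) (at (F s0)) (?d k)
      + frechet_derivative (\<Omega> (?d h) (?d k)) (at (F s0)) (?d l)" for h k l
    unfolding \<Psi>_def by (rule pb(2))
  have zero: "\<Psi> (z, 0) k s = 0" if s: "s \<in> W" for z k s
  proof -
    obtain y where y: "y \<in> fst c" "j y \<in> fst a" "s = snd c y" using s unfolding W_def by blast
    have y12: "fst y \<in> fst c1" "snd y \<in> fst c2" using y(1) c12(3) by auto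
    have "?t y (z, 0) \<in> first_factor_bundle B1 B2 y"
      using tangent_of_coords_left[OF B1 B2 c12(1,2) y12, of z] tangent_of_coords_in[OF B1 c12(1) y12(1)]
      by (auto simp: first_factor_bundle_def tangent_image_def c12(3)[symmetric])
    then have "\<phi> (j y) (?dj y (?t y (z, 0))) \<in> normal_tangent_space ?P A g j y"
      using assms(8)[of y] by blast
    then show ?thesis
      using tangent_of_coords_in[OF P c(1) y(1)]
      by (auto simp: y(3) \<Psi>[OF y(1,2)] normal_tangent_space_def tangent_image_def)
  qed
  have zero': "\<Psi> k (z, 0) s = 0" if "s \<in> W" for z k s
  proof -
    have "F s \<in> V" using FW that by blast
    then have "\<Psi> k (z, 0) s = - \<Psi> (z, 0) k s" unfolding \<Psi>_def by (rule anti)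
    then show ?thesis using zero[OF that] by simp
  qed
  \<comment> \<open>The form vanishes on vectors of the first factor throughout the neighbourhood
    \<open>W\<close>, so its derivatives vanish in every direction, including those of the second
    factor.\<close>
  have Dzero: "frechet_derivative (\<Psi> h k) (at s0) = (\<lambda>_. 0)" if "\<And>s. s \<in> W \<Longrightarrow> \<Psi> h k s = 0" for h k
  proof -
    have "(\<Psi> h k has_derivative (\<lambda>_. 0)) (at s0)"
      by (rule has_derivative_transform_within_open[OF has_derivative_const W s0W]) (use that in auto)
    then show ?thesis by (rule frechet_derivative_at[symmetric])
  qed
  obtain z1 where z1: "z1 \<in> tangent_space B1 p"
    "Z = differential B1 ?P (\<lambda>p. (p, q)) p z1"
    using Z x by (auto simp: first_factor_bundle_def tangent_image_def)
  define z where "z = z1 c1"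
  have Zt: "Z = ?t x (z, 0)"
    using tangent_of_coords_left[OF B1 B2 c12(1,2) pq, of z] tangent_of_coords_eq[OF B1 c12(1) pq(1) z1(1)]
    by (simp add: z1(2) z_def x c12(3)[symmetric])
  define H where "H = \<eta> (j x) (?dj x Z)"
  have H: "\<eta> (j x) (tangent_of_coords A a (j x) (frechet_derivative F (at s0) (z, 0))) = H"
    by (simp add: H_def Zt dj[OF c(2) a(2)] s0_def)
  \<comment> \<open>On either side of the cyclic identity two of the three terms feed
    \<open>(z, 0)\<close> into the form; only the derivative along \<open>(z, 0)\<close> is
    left.\<close>
  have evol: "frechet_derivative (\<Psi> (0, u) (0, w)) (at s0) (z, 0) = 2 * H * \<Psi> (0, u) (0, w) s0" for u w
  proof -
    let ?h = "(z, 0)" and ?k = "(0, u)" and ?l = "(0, w)"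
    have "frechet_derivative (\<Psi> ?k ?l) (at s0) ?h + frechet_derivative (\<Psi> ?l ?h) (at s0) ?k
        + frechet_derivative (\<Psi> ?h ?k) (at s0) ?l
      = 2 * (H * \<Psi> ?k ?l s0 + \<eta> (j x) (tangent_of_coords A a (j x) (?d ?k)) * \<Psi> ?l ?h s0
          + \<eta> (j x) (tangent_of_coords A a (j x) (?d ?l)) * \<Psi> ?h ?k s0)"
      unfolding \<Psi>cyc
      using coord_form_cyclic[OF A assms(3), of "j x" "?d ?k" "?d ?l" "?d ?h"] H
      by (simp add: \<Omega>_def \<Psi>_def a_def F0)
    then show ?thesis
      using Dzero[OF zero] Dzero[OF zero'] zero[OF s0W] zero'[OF s0W] by simp
  qed
  \<comment> \<open>The second factor has positive dimension, as every Euclidean space type has a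
    nonempty basis.\<close>
  obtain u :: 'd where u: "u \<noteq> 0" using nonempty_Basis nonzero_Basis by blast
  define N where "N = (\<lambda>w. g2 q (?t2 q w) (?t2 q w))"
  define L where "L = (\<lambda>p w. differential B2 A (\<lambda>q. j (p, q)) q (?t2 q w))"
  note fibre = warped_product_slant_fibre[OF A acm wp assms(5) assms(7) c12(2) pq(2)]
  have Npos: "N w > 0" if "w \<noteq> 0" for w
    unfolding N_def by (rule fibre(3)[OF that])
  have fibre_le: "g (j (p', q)) (\<phi> (j (p', q)) (L p' u)) (L p' w)
      \<le> cos \<theta> * (sqrt (N u) * sqrt (N w)) * (f p')\<^sup>2" if "w \<noteq> 0" for p' w
    unfolding N_def L_def by (rule fibre(1)[OF u that])
  have \<Psi>L: "\<Psi> (0, u) (0, w) (snd c (p', q)) = g (j (p', q)) (\<phi> (j (p', q)) (L p' u)) (L p' w)"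
    if p': "p' \<in> fst c1" "j (p', q) \<in> fst a" for p' u w
  proof -
    have y: "(p', q) \<in> fst c" using p' pq c12(3) by auto
    have "?dj (p', q) (?t (p', q) (0, v)) = L p' v" for v
      unfolding L_def
      using tangent_of_coords_right[OF B1 B2 c12(1,2) p'(1) pq(2), of v]
        differential_comp[OF B2 P diff_map_right_slice[OF B1 B2] j tangent_of_coords_in[OF B2 c12(2) pq(2)], of p' v]
      by (simp add: comp_def c12(3)[symmetric])
    then show ?thesis by (simp add: \<Psi>[OF y p'(2)])
  qed
  \<comment> \<open>The extremal direction at \<open>(p, q)\<close>. It stays fixed while the first
    component moves, where only \<open>fibre_le\<close> is available.\<close>
  obtain w where w: "w \<noteq> 0" and weq: "g (j (p, q)) (\<phi> (j (p, q)) (L p u)) (L p w)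
      = cos \<theta> * (sqrt (N u) * sqrt (N w)) * (f p)\<^sup>2"
    using fibre(2)[OF u, of p] unfolding N_def L_def by metis
  \<comment> \<open>Constant along the first factor, because \<open>N\<close> is computed at the
    fixed point \<open>q\<close>.\<close>
  define K where "K = cos \<theta> * (sqrt (N u) * sqrt (N w))"
  have K: "K \<noteq> 0" using fibre(4)[OF u] Npos[OF u] Npos[OF w] by (simp add: K_def)
  define f1 where "f1 = f \<circ> chart_inv c1"
  define f' where "f' = frechet_derivative f1 (at (snd c1 p))"
  have "smooth_on (snd c1 ` fst c1) f1" using fsm c12(1) by (simp add: smooth_fun_def f1_def)
  from smooth_on_imp_differentiable[OF this]
  have f': "(f1 has_derivative f') (at (snd c1 p))"
    using pq by (simp add: f'_def frechet_derivative_works)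
  have f1p: "f1 (snd c1 p) = f p" using B1 c12 pq by (simp add: f1_def)
  text \<open>The slant inequality along the line \<open>s0 + t (z, 0)\<close> is an equality at \<open>t = 0\<close>, so the two sides
    have equal derivatives there.\<close>
  define \<rho> where "\<rho> = (\<lambda>t. K * (f1 (snd c1 p + t *\<^sub>R z))\<^sup>2 - \<Psi> (0, u) (0, w) (s0 + t *\<^sub>R (z, 0)))"
  have "((\<lambda>t. f1 (snd c1 p + t *\<^sub>R z)) has_real_derivative f' z) (at 0)"
    by (rule has_real_derivative_along_line) (use f' in simp)
  moreover have "((\<lambda>t. \<Psi> (0, u) (0, w) (s0 + t *\<^sub>R (z, 0))) has_real_derivative
      2 * H * \<Psi> (0, u) (0, w) s0) (at 0)"
    unfolding evol[symmetric]
    by (rule has_real_derivative_along_line) (use \<Psi>diff[of "(0, u)" "(0, w)"] in \<open>simp add: frechet_derivative_works zero_prod_def[symmetric]\<close>)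
  ultimately have d\<rho>: "(\<rho> has_real_derivative
      K * (2 * f p * f' z) - 2 * H * \<Psi> (0, u) (0, w) s0) (at 0)"
    unfolding \<rho>_def by (auto intro!: derivative_eq_intros simp: f1p)
  have \<Psi>0: "\<Psi> (0, u) (0, w) s0 = K * (f p)\<^sup>2"
    using \<Psi>L[OF pq(1), of u w] a(2) weq by (simp add: K_def s0_def x)
  have "continuous_on UNIV (\<lambda>t. s0 + t *\<^sub>R (z, 0::'d))" by (intro continuous_intros)
  then have "open ((\<lambda>t. s0 + t *\<^sub>R (z, 0::'d)) -` W)" using W by (simp add: continuous_on_open_vimage)
  moreover have "0 \<in> (\<lambda>t. s0 + t *\<^sub>R (z, 0::'d)) -` W" using s0W by (simp add: zero_prod_def[symmetric])
  ultimately obtain d where d: "d > 0" "\<And>t. dist t 0 < d \<Longrightarrow> s0 + t *\<^sub>R (z, 0) \<in> W"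
    unfolding open_dist by (metis vimageE)
  have \<rho>0: "\<rho> 0 = 0" by (simp add: \<rho>_def f1p \<Psi>0 zero_prod_def[symmetric])
  have "\<rho> 0 \<le> \<rho> t" if "\<bar>0 - t\<bar> < d" for t
  proof -
    have "s0 + t *\<^sub>R (z, 0) \<in> W" using d(2) that by simp
    then obtain y where "y \<in> fst c \<inter> j -` fst a" and ys: "s0 + t *\<^sub>R (z, 0) = snd c y"
      unfolding W_def by (rule imageE)
    then have y: "y \<in> fst c" "j y \<in> fst a" "snd c y = s0 + t *\<^sub>R (z, 0)" by auto
    have y12: "fst y \<in> fst c1" "snd y \<in> fst c2" using y(1) c12(3) by auto
    \<comment> \<open>The line moves only the first coordinate, so injectivity of the second chart
      keeps the point on the slice through \<open>q\<close>, where the bound holds with the same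
      \<open>K\<close>.\<close>
    have y1: "snd c1 (fst y) = snd c1 p + t *\<^sub>R z" and "snd c2 (snd y) = snd c2 q"
      using y(3) c12(3) s0 by (cases y; simp)+
    then have yq: "snd y = q" using B2 c12(2) y12(2) pq(2) by (metis chart_inv_chart)
    then have yy: "y = (fst y, q)" by (metis prod.collapse)
    have "f1 (snd c1 p + t *\<^sub>R z) = f (fst y)"
      using y12(1) B1 c12(1) by (simp add: f1_def y1[symmetric])
    moreover have "\<Psi> (0, u) (0, w) (snd c y) \<le> K * (f (fst y))\<^sup>2"
      using \<Psi>L[OF y12(1), of u w] y(2) yy fibre_le[OF w, of "fst y"] by (simp add: K_def)
    ultimately show ?thesis unfolding \<rho>0 by (simp add: \<rho>_def y(3))
  qed
  then have "K * (2 * f p * f' z) - 2 * H * \<Psi> (0, u) (0, w) s0 = 0"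
    using DERIV_local_min[OF d\<rho> d(1)] by blast
  \<comment> \<open>The common factor can be cancelled since \<open>f p\<close> is positive and
    \<open>K\<close> nonzero; the latter is where properness of the slant enters.\<close>
  then have "(2 * K * f p) * (f' z) = (2 * K * f p) * (H * f p)"
    unfolding \<Psi>0 by (simp add: power2_eq_square algebra_simps)
  then have f'H: "f' z = H * f p" using K fpos[of p] by simp
  \<comment> \<open>In the product chart \<open>ln f\<close> depends on the first coordinate alone;
    its derivative along \<open>(z, 0)\<close> is \<open>f' z / f p\<close>, which equals
    \<open>H\<close>.\<close>
  have "((\<lambda>s. ln (f1 (fst s))) has_derivative (\<lambda>h. f' (fst h) / f p)) (at s0)"
  proof -
    have "((\<lambda>s. f1 (fst s)) has_derivative (\<lambda>h. f' (fst h))) (at s0)"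
      by (rule has_derivative_compose[OF has_derivative_fst[OF has_derivative_ident]]) (use f' in \<open>simp add: s0\<close>)
    from has_derivative_ln[OF _ this] show ?thesis
      using fpos[of p] by (simp add: s0 f1p divide_inverse mult.commute)
  qed
  then have "((\<lambda>y. ln (f (fst y))) \<circ> chart_inv c has_derivative (\<lambda>h. f' (fst h) / f p)) (at s0)"
    by (rule has_derivative_transform_within_open[OF _ atlas_chart(2)[OF P c(1)]])
      (use c(2) product_chart_inv[OF B1 B2 c12(1,2)] in
        \<open>auto simp: s0_def c12(3) f1_def map_prod_surj_on\<close>)
  from fun_cong[OF frechet_derivative_at[OF this], symmetric]
  have "dir_deriv ?P x Z (\<lambda>y. ln (f (fst y))) = f' z / f p"
    using P c by (simp add: dir_deriv_def Let_def c_def[symmetric] s0_def Zt)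
  then show "\<eta> (j x) (?dj x Z) = dir_deriv ?P x Z (\<lambda>y. ln (f (fst y)))"
    using f'H fpos[of p] by (simp add: H_def)
qed

end
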